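(* There is a randomized algorithm that, on input $\varepsilon>0$, $\delta>0$ and probability vectors $\langle p_1,\dots,p_n\rangle$ and $\langle q_1,\dots,q_n\rangle$ with $\frac12\le p_i<1$ and $0<q_i\le p_i$ for all $i$, runs in time polynomial in the input size, $1/\varepsilon$ and $1/\delta$, and outputs a number $v$ such that $(1-\varepsilon)\,d_{\mathrm{TV}}(P,Q)\le v\le(1+\varepsilon)\,d_{\mathrm{TV}}(P,Q)$ with probability at least $1-\delta$, where $P=\bigotimes_{i=1}^n\mathrm{Bern}(p_i)$ and $Q=\bigotimes_{i=1}^n\mathrm{Bern}(q_i)$ are the corresponding product distributions on $\{0,1\}^n$.
   Context: For distributions $P,Q$ on a finite set $\mathcal{D}$, $d_{\mathrm{TV}}(P,Q)=\frac12\sum_{x\in\mathcal{D}}|P(x)-Q(x)|$. $\mathrm{Bern}(p)$ is the Bernoulli distribution with probability $p$ of $1$, and $\bigotimes_i\mathrm{Bern}(p_i)$ assigns to $x\in\{0,1\}^n$ probability $\prod_{i:x_i=1}p_i\prod_{i:x_i=0}(1-p_i)$. The parameters are rationals given in binary with bit-length polynomial in $n$. *)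

theory Defs
  imports "HOL-Probability.Probability" "HOL-Library.Log_Nat"
begin

definition dTV :: "'a set \<Rightarrow> 'a pmf \<Rightarrow> 'a pmf \<Rightarrow> real" where
  "dTV D P Q = (\<Sum>x\<in>D. \<bar>pmf P x - pmf Q x\<bar>) / 2"

text \<open>
  A point of the cube \<open>{0,1}\<^sup>n\<close> is a function \<open>nat \<Rightarrow> bool\<close> that is \<open>False\<close> outside \<open>{..<n}\<close>;
  coordinates are numbered from 0.
\<close>

definition cube :: "nat \<Rightarrow> (nat \<Rightarrow> bool) set" where
  "cube n = PiE_dflt {..<n} False (\<lambda>_. UNIV)"

definition bern_prod :: "rat list \<Rightarrow> (nat \<Rightarrow> bool) pmf" where
  "bern_prod ps = Pi_pmf {..<length ps} False (\<lambda>i. bernoulli_pmf (of_rat (ps ! i)))"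

lemma pmf_bern_prod:
  assumes "\<forall>i<length ps. 0 \<le> ps ! i \<and> ps ! i \<le> 1" and "x \<in> cube (length ps)"
  shows "pmf (bern_prod ps) x =
    (\<Prod>i | i < length ps \<and> x i. of_rat (ps ! i)) *
    (\<Prod>i | i < length ps \<and> \<not> x i. 1 - of_rat (ps ! i))"
proof -
  have "pmf (bern_prod ps) x =
      (\<Prod>i<length ps. pmf (bernoulli_pmf (of_rat (ps ! i))) (x i))"
    using assms(2) unfolding bern_prod_def cube_def
    by (subst pmf_Pi) (auto simp: PiE_dflt_def)
  also have "\<dots> = (\<Prod>i<length ps. if x i then of_rat (ps ! i) else 1 - of_rat (ps ! i))"
    using assms(1) by (intro prod.cong) auto
  also have "\<dots> = (\<Prod>i\<in>{..<length ps} \<inter> {i. x i}. of_rat (ps ! i)) *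
      (\<Prod>i\<in>{..<length ps} \<inter> - {i. x i}. 1 - of_rat (ps ! i))"
    by (simp add: prod.If_cases)
  also have "{..<length ps} \<inter> {i. x i} = {i. i < length ps \<and> x i}" by blast
  also have "{..<length ps} \<inter> - {i. x i} = {i. i < length ps \<and> \<not> x i}" by blast
  finally show ?thesis .
qed

text \<open>
  Algorithms are programs of a while language over integer variables and integer arrays with
  unbounded indices, extended by a fair coin flip: a structured random access machine.
  Running time is the logarithmic (bit) cost: reading a number costs its bit length, additions,
  subtractions and comparisons cost the sum of the bit lengths of the operands, multiplication
  and integer division their product. Polynomial time in this model is polynomial time on
  (probabilistic) Turing machines.
\<close>

type_synonym vname = string

record state =
  ivar :: "vname \<Rightarrow> int"
  iarr :: "vname \<Rightarrow> int \<Rightarrow> int"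

text \<open>Length of the binary representation, including a sign bit; in particular it is positive.\<close>

definition bits :: "int \<Rightarrow> nat" where
  "bits k = Suc (nat (bitlen \<bar>k\<bar>))"

datatype aexp =
    Const int
  | Var vname
  | Read vname aexp
  | Plus aexp aexp
  | Minus aexp aexp
  | Times aexp aexp
  | Quot aexp aexp

datatype bexp =
    Less aexp aexp
  | Equal aexp aexp
  | Neg bexp
  | Conj bexp bexp

datatype com =
    Skip
  | Assign vname aexp
  | Store vname aexp aexp
  | Flip vname
  | Seq com com
  | Cond bexp com com
  | While bexp com

text \<open>\<open>Quot\<close> rounds towards minus infinity, and division by 0 yields 0.\<close>

primrec aval :: "aexp \<Rightarrow> state \<Rightarrow> int" where
  "aval (Const k) s = k"
| "aval (Var x) s = ivar s x"
| "aval (Read a e) s = iarr s a (aval e s)"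
| "aval (Plus e1 e2) s = aval e1 s + aval e2 s"
| "aval (Minus e1 e2) s = aval e1 s - aval e2 s"
| "aval (Times e1 e2) s = aval e1 s * aval e2 s"
| "aval (Quot e1 e2) s = aval e1 s div aval e2 s"

primrec bval :: "bexp \<Rightarrow> state \<Rightarrow> bool" where
  "bval (Less e1 e2) s \<longleftrightarrow> aval e1 s < aval e2 s"
| "bval (Equal e1 e2) s \<longleftrightarrow> aval e1 s = aval e2 s"
| "bval (Neg b) s \<longleftrightarrow> \<not> bval b s"
| "bval (Conj b1 b2) s \<longleftrightarrow> bval b1 s \<and> bval b2 s"

text \<open>
  The cost of an expression is at least the bit length of its value (\<open>bits_aval_le_acost\<close> below).
  Hence it also pays for using the value as an address or for storing it.
\<close>

primrec acost :: "aexp \<Rightarrow> state \<Rightarrow> nat" where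
  "acost (Const k) s = bits k"
| "acost (Var x) s = bits (ivar s x)"
| "acost (Read a e) s = acost e s + bits (iarr s a (aval e s))"
| "acost (Plus e1 e2) s = acost e1 s + acost e2 s + (bits (aval e1 s) + bits (aval e2 s))"
| "acost (Minus e1 e2) s = acost e1 s + acost e2 s + (bits (aval e1 s) + bits (aval e2 s))"
| "acost (Times e1 e2) s = acost e1 s + acost e2 s + bits (aval e1 s) * bits (aval e2 s)"
| "acost (Quot e1 e2) s = acost e1 s + acost e2 s + bits (aval e1 s) * bits (aval e2 s)"

primrec bcost :: "bexp \<Rightarrow> state \<Rightarrow> nat" where
  "bcost (Less e1 e2) s = acost e1 s + acost e2 s + (bits (aval e1 s) + bits (aval e2 s))"
| "bcost (Equal e1 e2) s = acost e1 s + acost e2 s + (bits (aval e1 s) + bits (aval e2 s))"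
| "bcost (Neg b) s = Suc (bcost b s)"
| "bcost (Conj b1 b2) s = Suc (bcost b1 s + bcost b2 s)"

definition set_var :: "vname \<Rightarrow> int \<Rightarrow> state \<Rightarrow> state" where
  "set_var x k s = s\<lparr>ivar := (ivar s)(x := k)\<rparr>"

definition set_arr :: "vname \<Rightarrow> int \<Rightarrow> int \<Rightarrow> state \<Rightarrow> state" where
  "set_arr a j k s = s\<lparr>iarr := (iarr s)(a := (iarr s a)(j := k))\<rparr>"

text \<open>
  \<open>exec c s \<omega> t s' \<omega>'\<close>: started in state \<open>s\<close> with the sequence \<open>\<omega>\<close> of future coin flips,
  program \<open>c\<close> halts after time \<open>t\<close> in state \<open>s'\<close>, and \<open>\<omega>'\<close> are the coins not yet flipped.
\<close>

inductive exec :: "com \<Rightarrow> state \<Rightarrow> bool stream \<Rightarrow> nat \<Rightarrow> state \<Rightarrow> bool stream \<Rightarrow> bool" where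
  exec_Skip: "exec Skip s \<omega> 1 s \<omega>"
| exec_Assign: "exec (Assign x e) s \<omega> (1 + acost e s) (set_var x (aval e s) s) \<omega>"
| exec_Store: "exec (Store a i e) s \<omega> (1 + acost i s + acost e s)
    (set_arr a (aval i s) (aval e s) s) \<omega>"
| exec_Flip: "exec (Flip x) s \<omega> 1 (set_var x (of_bool (shd \<omega>)) s) (stl \<omega>)"
| exec_Seq: "exec c1 s \<omega> t1 s1 \<omega>1 \<Longrightarrow> exec c2 s1 \<omega>1 t2 s2 \<omega>2 \<Longrightarrow>
    exec (Seq c1 c2) s \<omega> (t1 + t2) s2 \<omega>2"
| exec_CondT: "bval b s \<Longrightarrow> exec c1 s \<omega> t s' \<omega>' \<Longrightarrow>
    exec (Cond b c1 c2) s \<omega> (1 + bcost b s + t) s' \<omega>'"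
| exec_CondF: "\<not> bval b s \<Longrightarrow> exec c2 s \<omega> t s' \<omega>' \<Longrightarrow>
    exec (Cond b c1 c2) s \<omega> (1 + bcost b s + t) s' \<omega>'"
| exec_WhileF: "\<not> bval b s \<Longrightarrow> exec (While b c) s \<omega> (1 + bcost b s) s \<omega>"
| exec_WhileT: "bval b s \<Longrightarrow> exec c s \<omega> t1 s1 \<omega>1 \<Longrightarrow> exec (While b c) s1 \<omega>1 t2 s2 \<omega>2 \<Longrightarrow>
    exec (While b c) s \<omega> (1 + bcost b s + t1 + t2) s2 \<omega>2"

text \<open>The law of an infinite sequence of independent fair coin flips.\<close>

definition coins :: "bool stream measure" where
  "coins = stream_space (measure_pmf (bernoulli_pmf (1/2)))"

inductive_cases exec_SkipE: "exec Skip s \<omega> t s' \<omega>'"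
inductive_cases exec_AssignE: "exec (Assign x e) s \<omega> t s' \<omega>'"
inductive_cases exec_StoreE: "exec (Store a i e) s \<omega> t s' \<omega>'"
inductive_cases exec_FlipE: "exec (Flip x) s \<omega> t s' \<omega>'"
inductive_cases exec_SeqE: "exec (Seq c1 c2) s \<omega> t s' \<omega>'"
inductive_cases exec_CondE: "exec (Cond b c1 c2) s \<omega> t s' \<omega>'"
inductive_cases exec_WhileE: "exec (While b c) s \<omega> t s' \<omega>'"

lemma exec_deterministic:
  assumes "exec c s \<omega> t s1 \<omega>1" and "exec c s \<omega> u s2 \<omega>2"
  shows "t = u \<and> s1 = s2 \<and> \<omega>1 = \<omega>2"
  using assms
proof (induction arbitrary: u s2 \<omega>2 rule: exec.induct)
  case (exec_Seq c1 s \<omega> t1 s1 \<omega>1 c2 t2 s2' \<omega>2')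
  from exec_Seq.prems obtain v1 r \<rho> v2 where
    *: "exec c1 s \<omega> v1 r \<rho>" "exec c2 r \<rho> v2 s2 \<omega>2" "u = v1 + v2"
    by (rule exec_SeqE)
  note eq = exec_Seq.IH(1)[OF *(1)]
  from *(2) eq have "exec c2 s1 \<omega>1 v2 s2 \<omega>2" by simp
  from exec_Seq.IH(2)[OF this] eq *(3) show ?case by simp
next
  case (exec_CondT b s c1 \<omega> t s' \<omega>' c2)
  from exec_CondT.prems obtain v where
    *: "exec c1 s \<omega> v s2 \<omega>2" "u = 1 + bcost b s + v"
    by (rule exec_CondE) (use exec_CondT.hyps(1) in auto)
  from exec_CondT.IH[OF *(1)] *(2) show ?case by simp
next
  case (exec_CondF b s c2 \<omega> t s' \<omega>' c1)
  from exec_CondF.prems obtain v where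
    *: "exec c2 s \<omega> v s2 \<omega>2" "u = 1 + bcost b s + v"
    by (rule exec_CondE) (use exec_CondF.hyps(1) in auto)
  from exec_CondF.IH[OF *(1)] *(2) show ?case by simp
next
  case (exec_WhileF b s c \<omega>)
  from exec_WhileF.prems show ?case
    by (rule exec_WhileE) (use exec_WhileF.hyps(1) in auto)
next
  case (exec_WhileT b s c \<omega> t1 s1 \<omega>1 t2 s2' \<omega>2')
  from exec_WhileT.prems obtain v1 r \<rho> v2 where
    *: "exec c s \<omega> v1 r \<rho>" "exec (While b c) r \<rho> v2 s2 \<omega>2" "u = 1 + bcost b s + v1 + v2"
    by (rule exec_WhileE) (use exec_WhileT.hyps(1) in auto)
  note eq = exec_WhileT.IH(1)[OF *(1)]
  from *(2) eq have "exec (While b c) s1 \<omega>1 v2 s2 \<omega>2" by simp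
  from exec_WhileT.IH(2)[OF this] eq *(3) show ?case by simp
qed (auto elim: exec_SkipE exec_AssignE exec_StoreE exec_FlipE)

lemma bits_less_iff: "\<bar>k\<bar> < 2 ^ m \<longleftrightarrow> bits k \<le> Suc m"
  using bitlen_le_iff_power[of "\<bar>k\<bar>" m] by (simp add: bits_def nat_le_iff)

lemma bits_aval_le_acost: "bits (aval e s) \<le> acost e s"
proof -
  have pos: "0 < bits k" for k by (simp add: bits_def)
  have lt: "\<bar>k\<bar> < 2 ^ (bits k - 1)" for k using bits_less_iff[of k "bits k - 1"] pos[of k] by simp
  have add: "bits k \<le> bits a + bits b" if "\<bar>k\<bar> \<le> \<bar>a\<bar> + \<bar>b\<bar>" for a b k
  proof -
    define m where "m = max (bits a - 1) (bits b - 1)"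
    have "\<bar>a\<bar> < 2 ^ m" "\<bar>b\<bar> < 2 ^ m"
      unfolding bits_less_iff by (auto simp: m_def)
    then have "\<bar>k\<bar> < 2 ^ Suc m" using that by simp
    then have "bits k \<le> Suc (Suc m)" by (simp only: bits_less_iff)
    then show ?thesis using pos[of a] pos[of b] by (auto simp: m_def max_def split: if_splits)
  qed
  have mul: "bits (a * b) \<le> bits a * bits b" for a b
  proof -
    have "\<bar>a\<bar> * \<bar>b\<bar> < 2 ^ (bits a - 1) * 2 ^ (bits b - 1)"
      by (intro mult_strict_mono lt) auto
    then have "\<bar>a * b\<bar> < 2 ^ (bits a - 1 + (bits b - 1))" by (simp add: abs_mult power_add)
    then have "bits (a * b) \<le> Suc (bits a - 1 + (bits b - 1))" by (simp only: bits_less_iff)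
    also have "\<dots> \<le> bits a * bits b"
      using pos[of a] pos[of b] by (cases "bits a"; cases "bits b") auto
    finally show ?thesis .
  qed
  have quot: "bits (a div b) \<le> acost e1 s + acost e2 s + bits a * bits b"
    if "bits a \<le> acost e1 s" for a b e1 e2
  proof -
    have le: "\<bar>x div y\<bar> \<le> \<bar>x\<bar>" if "0 < y" for x y :: int
    proof (cases "0 \<le> x")
      case True
      then show ?thesis
        using zdiv_mono2[of x 1 y] pos_imp_zdiv_nonneg_iff[of y x] that by simp
    next
      case False
      then show ?thesis
        using zdiv_mono2_neg[of x 1 y] pos_imp_zdiv_neg_iff[of y x] that by simp
    qed
    have "\<bar>a div b\<bar> \<le> \<bar>a\<bar>"
    proof (cases b "0 :: int" rule: linorder_cases)
      case less
      then show ?thesis using le[of "- b" "- a"] by simp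
    qed (simp_all add: le)
    then have "\<bar>a div b\<bar> < 2 ^ (bits a - 1)" using lt[of a] by linarith
    then have "bits (a div b) \<le> bits a" using pos[of a] by (simp add: bits_less_iff)
    with that show ?thesis by simp
  qed
  show ?thesis
  proof (induction e)
    case (Plus e1 e2)
    show ?case using add[OF abs_triangle_ineq, of "aval e1 s" "aval e2 s"] by simp
  next
    case (Minus e1 e2)
    show ?case using add[OF abs_triangle_ineq4, of "aval e1 s" "aval e2 s"] by simp
  next
    case (Times e1 e2)
    show ?case using mul[of "aval e1 s" "aval e2 s"] by simp
  next
    case (Quot e1 e2)
    then show ?case using quot[of "aval e1 s" e1 "aval e2 s" e2] by simp
  qed auto
qed

definition num :: "rat \<Rightarrow> int" where
  "num r = fst (quotient_of r)"

definition den :: "rat \<Rightarrow> int" where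
  "den r = snd (quotient_of r)"

definition rat_bits :: "rat \<Rightarrow> nat" where
  "rat_bits r = bits (num r) + bits (den r)"

definition input_size :: "rat \<Rightarrow> rat \<Rightarrow> rat list \<Rightarrow> rat list \<Rightarrow> nat" where
  "input_size \<epsilon> \<delta> ps qs =
    rat_bits \<epsilon> + rat_bits \<delta> + sum_list (map rat_bits ps) + sum_list (map rat_bits qs)"

definition array_of :: "int list \<Rightarrow> int \<Rightarrow> int" where
  "array_of ks j = (if 0 \<le> j \<and> j < int (length ks) then ks ! nat j else 0)"

definition input_state :: "rat \<Rightarrow> rat \<Rightarrow> rat list \<Rightarrow> rat list \<Rightarrow> state" where
  "input_state \<epsilon> \<delta> ps qs = \<lparr>
    ivar = (\<lambda>_. 0)(
      ''n'' := int (length ps),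
      ''eps_num'' := num \<epsilon>, ''eps_den'' := den \<epsilon>,
      ''delta_num'' := num \<delta>, ''delta_den'' := den \<delta>),
    iarr = (\<lambda>_ _. 0)(
      ''p_num'' := array_of (map num ps), ''p_den'' := array_of (map den ps),
      ''q_num'' := array_of (map num qs), ''q_den'' := array_of (map den qs))\<rparr>"

text \<open>
  With coins \<open>\<omega>\<close>, program \<open>c\<close> started in \<open>s\<close> halts after time \<open>t\<close> and outputs the rational \<open>v\<close>
  as a fraction in the variables \<open>out_num\<close> and \<open>out_den\<close>.
\<close>

definition outputs :: "com \<Rightarrow> state \<Rightarrow> bool stream \<Rightarrow> nat \<Rightarrow> real \<Rightarrow> bool" where
  "outputs c s \<omega> t v \<longleftrightarrow> (\<exists>s' \<omega>'. exec c s \<omega> t s' \<omega>' \<and> ivar s' ''out_den'' > 0 \<and>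
     v = of_int (ivar s' ''out_num'') / of_int (ivar s' ''out_den''))"

end

theory Submission
  imports Defs
begin

text \<open>
  The algorithm is deterministic. It processes the coordinates one after the other and keeps, instead of
  the \<open>2\<^sup>i\<close> pairs \<open>(P(x), Q(x))\<close> for the prefixes \<open>x\<close> of length \<open>i\<close>, only polynomially many pairs:
  prefixes for which \<open>|P(x) - Q(x)| / Q(x)\<close> has the same sign and agrees up to a factor \<open>1 + 1/N\<close> are
  merged by adding up their masses. The final distance depends on a pair \<open>(u, v)\<close> through a function
  that is sublinear and Lipschitz in \<open>u\<close>, so that merging only decreases the result, and one round of
  merging costs at most \<open>(1/N) \<Sum>|P(x) - Q(x)|\<close>, which is at most \<open>2/N\<close> times the distance. With
  \<open>N > 2 n / \<epsilon>\<close> the total relative error is at most \<open>\<epsilon>\<close>. After scaling by the common denominator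
  \<open>M\<close> all masses are integers in \<open>{0..M}\<close>, hence a nonzero ratio lies between \<open>1/M\<close> and \<open>M\<close> and
  \<open>O(N log M)\<close> merging classes suffice.
\<close>

section \<open>Merging classes\<close>

text \<open>Classes are formed from \<open>|u - v| / v\<close> and not from \<open>u / v\<close>
  because the distance may be exponentially small compared with the masses. A relative error in
  \<open>u / v\<close> perturbs an atom in proportion to its mass, whereas a relative error in
  \<open>|u - v| / v\<close> perturbs it in proportion to \<open>|u - v|\<close>. These differences
  can be charged to the distance: P and Q have equal total mass in every layer, so the sum of
  \<open>|u - v|\<close> is twice the sum of the positive parts, and further coordinates do not
  decrease the distance. Dividing by \<open>v\<close> fits the homogeneity of the contribution: an
  atom is compared with its share \<open>v a / V\<close> of the merged atom, a pair with the same
  second component. All arithmetic on masses is exact, so merging is the only source of error. For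
  the running time, two kinds of numbers have to be kept apart. \<open>n\<close>, \<open>N\<close>
  and the number of buckets govern loop counts and must be polynomial in value; \<open>M\<close> and
  the masses may be exponentially large, and only their bit length matters.\<close>

text \<open>
  If \<open>z div 2\<^sup>e\<close> lies in \<open>{N..<2N}\<close>, the index of \<open>z\<close> is \<open>e N + z div 2\<^sup>e\<close>: it encodes the exponent and
  the leading digits of \<open>z\<close>, as in a floating-point representation.
\<close>

function scale_index :: "int \<Rightarrow> int \<Rightarrow> int" where
  "scale_index N z = (if N \<le> 0 \<or> z < 2 * N then z else N + scale_index N (z div 2))"
  by auto
termination by (relation "Wellfounded.measure (\<lambda>(N, z). nat z)") auto

declare scale_index.simps [simp del]

lemma scale_index_less: "z < 2 * N \<Longrightarrow> scale_index N z = z"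
  by (simp add: scale_index.simps[of N z])

lemma scale_index_ge: "0 < N \<Longrightarrow> 2 * N \<le> z \<Longrightarrow> scale_index N z = N + scale_index N (z div 2)"
  by (simp add: scale_index.simps[of N z])

lemma scale_index_eq:
  assumes "0 < N" and "N \<le> z"
  obtains e :: nat where "N \<le> z div 2 ^ e" and "z div 2 ^ e < 2 * N"
    and "scale_index N z = int e * N + z div 2 ^ e"
proof -
  have "\<exists>e::nat. N \<le> z div 2 ^ e \<and> z div 2 ^ e < 2 * N \<and> scale_index N z = int e * N + z div 2 ^ e"
    using assms
  proof (induction "nat z" arbitrary: z rule: less_induct)
    case less
    show ?case
    proof (cases "z < 2 * N")
      case True
      then show ?thesis using less.prems by (intro exI[of _ 0]) (simp add: scale_index_less)
    next
      case False
      then have *: "nat (z div 2) < nat z" "N \<le> z div 2" using less.prems by auto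
      from less.hyps[OF *(1) less.prems(1) *(2)] obtain e :: nat where
        e: "N \<le> z div 2 div 2 ^ e" "z div 2 div 2 ^ e < 2 * N"
          "scale_index N (z div 2) = int e * N + z div 2 div 2 ^ e" by blast
      have "z div 2 div 2 ^ e = z div 2 ^ Suc e" by (simp add: zdiv_zmult2_eq)
      with e False less.prems show ?thesis
        by (intro exI[of _ "Suc e"]) (simp add: scale_index_ge algebra_simps)
    qed
  qed
  then show ?thesis using that by blast
qed

lemma scale_index_nonneg: "0 < N \<Longrightarrow> 0 \<le> z \<Longrightarrow> 0 \<le> scale_index N z"
  by (induction N z rule: scale_index.induct) (subst scale_index.simps, auto)

lemma scale_index_pos: "0 < N \<Longrightarrow> 0 < z \<Longrightarrow> 0 < scale_index N z"
proof (cases "z < 2 * N")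
  case False
  assume "0 < N" "0 < z"
  then show ?thesis using scale_index_nonneg[of N "z div 2"] False by (simp add: scale_index_ge)
qed (simp add: scale_index_less)

lemma scale_index_mono: "0 < N \<Longrightarrow> 0 \<le> y \<Longrightarrow> y \<le> z \<Longrightarrow> scale_index N y \<le> scale_index N z"
proof (induction N z arbitrary: y rule: scale_index.induct)
  case (1 N z)
  show ?case
  proof (cases "z < 2 * N")
    case True
    then show ?thesis using 1 by (simp add: scale_index_less)
  next
    case z: False
    then have z': "scale_index N z = N + scale_index N (z div 2)" using 1 by (simp add: scale_index_ge)
    show ?thesis
    proof (cases "y < 2 * N")
      case True
      \<comment> \<open>Here \<open>min y N \<le> N \<le> z div 2\<close>, so the induction
        hypothesis applies. If \<open>N \<le> y\<close>, it gives \<open>z\<close> an index of at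
        least \<open>2 * N\<close>, which exceeds \<open>y\<close>; otherwise it bounds
        \<open>y\<close> directly.\<close>
      have "scale_index N (min y N) \<le> scale_index N (z div 2)"
        using 1 z by auto
      then show ?thesis using True z' 1 by (auto simp: scale_index_less min_def split: if_splits)
    next
      case False
      then show ?thesis using 1 z z' by (auto simp: scale_index_ge)
    qed
  qed
qed

text \<open>At most \<open>m\<close> halvings, each adding \<open>N\<close>, lead to a number below
  \<open>2 * N\<close>. This logarithmic growth keeps the number of buckets polynomial although
  \<open>M\<close> is exponentially large.\<close>

lemma scale_index_le:
  "0 < N \<Longrightarrow> z < 2 ^ m \<Longrightarrow> scale_index N z \<le> N * int (m + 2)"
proof (induction m arbitrary: z)
  case 0
  then show ?case by (simp add: scale_index_less)
next
  case (Suc m)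
  show ?case
  proof (cases "z < 2 * N")
    case True
    have "2 * N \<le> N * int (Suc m + 2)" using Suc.prems by (simp add: algebra_simps)
    with True show ?thesis by (simp add: scale_index_less)
  next
    case False
    have "scale_index N (z div 2) \<le> N * int (m + 2)" using Suc by simp
    then show ?thesis using False Suc.prems by (simp add: scale_index_ge algebra_simps)
  qed
qed

text \<open>Equal indices mean equal exponent \<open>e\<close> and equal leading part, hence a
  difference of at most \<open>2 ^ e\<close>, while the leading part is at least \<open>N\<close>
  and so \<open>x\<close> is at least \<open>N * 2 ^ e\<close>. The arguments are real because the
  ratios are rounded down before they are indexed.\<close>

lemma scale_index_eq_close:
  fixes x y :: real
  assumes N: "0 < N" and ge: "N \<le> \<lfloor>x\<rfloor>" "N \<le> \<lfloor>y\<rfloor>"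
    and eq: "scale_index N \<lfloor>x\<rfloor> = scale_index N \<lfloor>y\<rfloor>"
  shows "\<bar>x - y\<bar> \<le> x / of_int N"
proof -
  obtain e where e: "N \<le> \<lfloor>x\<rfloor> div 2 ^ e" "\<lfloor>x\<rfloor> div 2 ^ e < 2 * N"
    "scale_index N \<lfloor>x\<rfloor> = int e * N + \<lfloor>x\<rfloor> div 2 ^ e" using scale_index_eq[OF N ge(1)] .
  obtain f where f: "N \<le> \<lfloor>y\<rfloor> div 2 ^ f" "\<lfloor>y\<rfloor> div 2 ^ f < 2 * N"
    "scale_index N \<lfloor>y\<rfloor> = int f * N + \<lfloor>y\<rfloor> div 2 ^ f" using scale_index_eq[OF N ge(2)] .
  \<comment> \<open>Exponent \<open>e\<close> owns the indices from \<open>(e + 1) * N\<close> up to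
    but excluding \<open>(e + 2) * N\<close>. These blocks are disjoint, so the index determines the
    exponent.\<close>
  have "int e * N + N < int f * N + 2 * N" "int f * N + N < int e * N + 2 * N"
    using e f eq by linarith+
  then have "int e * N < int (Suc f) * N" "int f * N < int (Suc e) * N"
    by (simp_all add: algebra_simps)
  then have "e = f" using N by (simp only: mult_less_cancel_right) linarith
  define \<zeta> where "\<zeta> = \<lfloor>x\<rfloor> div 2 ^ e"
  have \<zeta>: "\<lfloor>y\<rfloor> div 2 ^ e = \<zeta>" using e f eq \<open>e = f\<close> by (simp add: \<zeta>_def)
  have fl: "of_int \<zeta> * 2 ^ e \<le> r \<and> r < (of_int \<zeta> + 1) * 2 ^ e" if "\<lfloor>r\<rfloor> div 2 ^ e = \<zeta>" for r :: real
  proof -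
    have "\<zeta> = \<lfloor>r / 2 ^ e\<rfloor>" using that floor_divide_real_eq_div[of "2 ^ e" r] by simp
    then have "of_int \<zeta> \<le> r / 2 ^ e" "r / 2 ^ e < of_int \<zeta> + 1" by linarith+
    then show ?thesis by (simp add: field_simps)
  qed
  have "\<bar>x - y\<bar> \<le> 2 ^ e"
    using fl[OF \<zeta>] fl[OF \<zeta>_def[symmetric]] by (auto simp: algebra_simps)
  also have "\<dots> \<le> x / of_int N"
  proof -
    have "of_int N * (2::real) ^ e \<le> of_int \<zeta> * 2 ^ e" using e(1) by (simp add: \<zeta>_def)
    also have "\<dots> \<le> x" using fl[OF \<zeta>_def[symmetric]] by simp
    finally show ?thesis using N by (simp add: field_simps)
  qed
  finally show ?thesis .
qed

text \<open>
  \<open>\<alpha> i b\<close> and \<open>\<beta> i b\<close> are the probabilities of bit \<open>b\<close> at coordinate \<open>i\<close> under \<open>P\<close> and \<open>Q\<close>, scaled by a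
  common denominator \<open>D i\<close>.
\<close>

locale weights =
  fixes n :: nat and N :: int and \<alpha> \<beta> :: "nat \<Rightarrow> bool \<Rightarrow> int" and D :: "nat \<Rightarrow> int"
  assumes N_pos: "0 < N"
    and \<alpha>_nonneg: "0 \<le> \<alpha> i b" and \<beta>_nonneg: "0 \<le> \<beta> i b" and \<beta>_pos: "i < n \<Longrightarrow> 0 < \<beta> i b"
    and \<alpha>_sum: "\<alpha> i False + \<alpha> i True = D i" and \<beta>_sum: "\<beta> i False + \<beta> i True = D i"
begin

text \<open>
  An atom with masses \<open>u\<close> and \<open>v\<close> contributes \<open>tail m i u v\<close> to \<open>M\<close> times the distance, after the
  coordinates \<open>i, \<dots>, i + m - 1\<close> have been added to it.
\<close>

primrec tail :: "nat \<Rightarrow> nat \<Rightarrow> real \<Rightarrow> real \<Rightarrow> real" where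
  "tail 0 i u v = max 0 (u - v)"
| "tail (Suc m) i u v = (\<Sum>b\<in>UNIV. tail m (Suc i) (u * of_int (\<alpha> i b)) (v * of_int (\<beta> i b)))"

text \<open>The factor by which \<open>m\<close> further coordinates multiply the total mass of an
  atom. It is the same for P and Q, since both weights of coordinate \<open>l\<close> sum to
  \<open>D l\<close>.\<close>

definition R :: "nat \<Rightarrow> nat \<Rightarrow> real" where "R m i = (\<Prod>l\<in>{i..<i+m}. of_int (D l))"

lemma R_0 [simp]: "R 0 i = 1" by (simp add: R_def)

lemma R_Suc: "R (Suc m) i = of_int (D i) * R m (Suc i)"
proof -
  have "{i..<i + Suc m} = insert i {Suc i..<Suc i + m}" by auto
  then show ?thesis by (simp add: R_def)
qed

lemma D_nonneg: "0 \<le> D i" using \<alpha>_nonneg[of i True] \<alpha>_nonneg[of i False] \<alpha>_sum[of i] by linarith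

lemma D_pos: "i < n \<Longrightarrow> 0 < D i" using \<beta>_pos[of i True] \<beta>_pos[of i False] \<beta>_sum[of i] by linarith

lemma R_nonneg: "0 \<le> R m i" unfolding R_def by (intro prod_nonneg) (simp add: D_nonneg)

lemma of_int_\<alpha>_sum: "of_int (\<alpha> i False) + of_int (\<alpha> i True) = (of_int (D i) :: real)"
  using \<alpha>_sum[of i] by (metis of_int_add)

lemma of_int_\<beta>_sum: "of_int (\<beta> i False) + of_int (\<beta> i True) = (of_int (D i) :: real)"
  using \<beta>_sum[of i] by (metis of_int_add)

section \<open>Sublinearity and Lipschitz continuity of the contribution of an atom\<close>

lemma tail_nonneg: "0 \<le> tail m i u v"
  by (induction m arbitrary: i u v) (auto intro!: sum_nonneg)

lemma tail_zero [simp]: "tail m i 0 0 = 0"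
  by (induction m arbitrary: i) auto

lemma tail_scale: "0 \<le> c \<Longrightarrow> tail m i (c * u) (c * v) = c * tail m i u v"
proof (induction m arbitrary: i u v)
  case 0
  then show ?case by (simp add: max_mult_distrib_left right_diff_distrib)
next
  case (Suc m)
  then show ?case by (simp add: UNIV_bool mult.assoc distrib_left)
qed

text \<open>The positive part is subadditive, and each coordinate acts linearly on the pair. Masses
  of opposite sign may cancel, so equality fails in general.\<close>

lemma tail_subadditive: "tail m i (u + u') (v + v') \<le> tail m i u v + tail m i u' v'"
proof (induction m arbitrary: i u v u' v')
  case (Suc m)
  show ?case unfolding tail.simps sum.distrib[symmetric] distrib_right by (intro sum_mono Suc.IH)
qed auto

lemma tail_sum_le: "tail m i (sum u A) (sum v A) \<le> (\<Sum>a\<in>A. tail m i (u a) (v a))"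
proof (induction A rule: infinite_finite_induct)
  case (insert a A)
  then show ?case using tail_subadditive[of m i "u a" "sum u A" "v a" "sum v A"] by simp
qed auto

text \<open>A coordinate splits the difference \<open>u - u'\<close> in the proportions
  \<open>\<alpha> i b\<close>, whose sum is \<open>D i\<close>, so the Lipschitz constants multiply
  up to \<open>R m i\<close>.\<close>

lemma tail_lipschitz: "\<bar>tail m i u v - tail m i u' v\<bar> \<le> \<bar>u - u'\<bar> * R m i"
proof (induction m arbitrary: i u v u')
  case (Suc m)
  have "\<bar>tail (Suc m) i u v - tail (Suc m) i u' v\<bar>
      \<le> (\<Sum>b\<in>UNIV. \<bar>u * of_int (\<alpha> i b) - u' * of_int (\<alpha> i b)\<bar> * R m (Suc i))"
    unfolding tail.simps sum_subtractf[symmetric] by (rule order_trans[OF sum_abs sum_mono[OF Suc.IH]])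
  also have "\<dots> = (\<Sum>b\<in>UNIV. \<bar>u - u'\<bar> * of_int (\<alpha> i b) * R m (Suc i))"
    by (simp add: left_diff_distrib[symmetric] abs_mult \<alpha>_nonneg)
  also have "\<dots> = \<bar>u - u'\<bar> * ((of_int (\<alpha> i False) + of_int (\<alpha> i True)) * R m (Suc i))"
    by (simp add: UNIV_bool algebra_simps)
  also have "\<dots> = \<bar>u - u'\<bar> * R (Suc m) i" by (simp add: R_Suc of_int_\<alpha>_sum)
  finally show ?case .
qed auto

text \<open>The positive part dominates its argument, and the signed difference is multiplied by
  \<open>R m i\<close> exactly. With \<open>tail_nonneg\<close> this bounds the contribution below
  by the positive part of \<open>u - v\<close>.\<close>

lemma tail_ge: "(u - v) * R m i \<le> tail m i u v"
proof (induction m arbitrary: i u v)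
  case (Suc m)
  have "(u - v) * R (Suc m) i = (u * (of_int (\<alpha> i False) + of_int (\<alpha> i True)) -
      v * (of_int (\<beta> i False) + of_int (\<beta> i True))) * R m (Suc i)"
    by (simp add: R_Suc of_int_\<alpha>_sum of_int_\<beta>_sum algebra_simps)
  also have "\<dots> = (\<Sum>b\<in>UNIV. (u * of_int (\<alpha> i b) - v * of_int (\<beta> i b)) * R m (Suc i))"
    by (simp add: UNIV_bool algebra_simps)
  also have "\<dots> \<le> tail (Suc m) i u v" unfolding tail.simps by (rule sum_mono[OF Suc.IH])
  finally show ?case .
qed auto

text \<open>The contribution of the merged atom \<open>(U, V)\<close> is split into shares
  \<open>v a / V\<close>. By homogeneity the share of \<open>a\<close> is the contribution of a pair
  with second component \<open>v a\<close>, so it differs from that of \<open>(u a, v a)\<close> in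
  the first component only and the Lipschitz bound applies. That first component is an average of
  the values \<open>u c * v a / v c\<close> with weights \<open>v c / V\<close> (over nonzero
  \<open>v c\<close>), which is why pairwise closeness suffices.\<close>

lemma tail_merge:
  assumes nonneg: "\<And>a. a \<in> A \<Longrightarrow> 0 \<le> v a"
    and zero: "\<And>a. a \<in> A \<Longrightarrow> v a = 0 \<Longrightarrow> u a = 0"
    and fin: "finite A"
    and close: "\<And>a c. a \<in> A \<Longrightarrow> c \<in> A \<Longrightarrow> \<bar>u a * v c - u c * v a\<bar> \<le> \<eta> * \<bar>u a - v a\<bar> * v c"
  shows "(\<Sum>a\<in>A. tail m i (u a) (v a)) - tail m i (sum u A) (sum v A)
    \<le> \<eta> * R m i * (\<Sum>a\<in>A. \<bar>u a - v a\<bar>)"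
proof (cases "sum v A = 0")
  case True
  then have "v a = 0" if "a \<in> A" for a using that nonneg fin sum_nonneg_eq_0_iff[of A v] by simp
  with zero show ?thesis by simp
next
  case False
  define V where "V = sum v A"
  define U where "U = sum u A"
  have V: "0 < V" using False sum_nonneg[of A v] nonneg unfolding V_def by fastforce
  have "tail m i (u a) (v a) - v a / V * tail m i U V \<le> \<eta> * R m i * \<bar>u a - v a\<bar>" if a: "a \<in> A" for a
  proof -
    have "v a / V * tail m i U V = tail m i (v a / V * U) (v a)"
      using tail_scale[of "v a / V" m i U V] nonneg[OF a] V by simp
    then have le: "tail m i (u a) (v a) - v a / V * tail m i U V \<le> \<bar>u a - v a / V * U\<bar> * R m i"
      using tail_lipschitz[of m i "u a" "v a" "v a / V * U"] by simp
    have "u a - v a / V * U = (u a * V - U * v a) / V" using V by (simp add: field_simps)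
    also have "u a * V - U * v a = (\<Sum>c\<in>A. u a * v c - u c * v a)"
      by (simp add: U_def V_def sum_subtractf sum_distrib_left sum_distrib_right)
    finally have "\<bar>u a - v a / V * U\<bar> * V = \<bar>\<Sum>c\<in>A. u a * v c - u c * v a\<bar>"
      using V by simp
    also have "\<dots> \<le> (\<Sum>c\<in>A. \<eta> * \<bar>u a - v a\<bar> * v c)"
      by (rule order_trans[OF sum_abs sum_mono[OF close[OF a]]])
    also have "\<dots> = \<eta> * \<bar>u a - v a\<bar> * V" by (simp add: V_def sum_distrib_left)
    finally have "\<bar>u a - v a / V * U\<bar> \<le> \<eta> * \<bar>u a - v a\<bar>"
      using V by (simp only: mult_le_cancel_right_pos)
    then have "\<bar>u a - v a / V * U\<bar> * R m i \<le> \<eta> * \<bar>u a - v a\<bar> * R m i"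
      by (rule mult_right_mono[OF _ R_nonneg])
    also have "\<dots> = \<eta> * R m i * \<bar>u a - v a\<bar>" by (simp only: mult_ac)
    finally show ?thesis using le by (rule order_trans[rotated])
  qed
  then have "(\<Sum>a\<in>A. tail m i (u a) (v a) - v a / V * tail m i U V) \<le> (\<Sum>a\<in>A. \<eta> * R m i * \<bar>u a - v a\<bar>)"
    by (rule sum_mono)
  moreover have "(\<Sum>a\<in>A. v a / V * tail m i U V) = tail m i U V"
    using V by (simp add: sum_distrib_right[symmetric] sum_divide_distrib[symmetric] V_def)
  ultimately show ?thesis by (simp add: sum_subtractf sum_distrib_left U_def V_def)
qed

section \<open>Buckets and layers of merged atoms\<close>

definition M :: int where "M = (\<Prod>i<n. D i)"

text \<open>The largest index that \<open>bucket\<close> can produce in absolute value: the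
  difference of the masses is at most \<open>M\<close>, and dividing by a nonnegative integer does
  not increase \<open>M * M * N\<close>, even for divisor 0.\<close>

definition B :: int where "B = scale_index N (M * M * N)"

text \<open>
  Empty atoms (\<open>u = v = 0\<close>) fall into bucket 0, because division by 0 yields 0.
\<close>

definition bucket :: "int \<Rightarrow> int \<Rightarrow> int" where
  "bucket u v = (if u < v then - scale_index N ((v - u) * M * N div v)
    else scale_index N ((u - v) * M * N div v))"

text \<open>The empty prefix has masses 1 and 1, hence difference 0, and starts in bucket 0. An atom
  \<open>(j, b)\<close> is bucket \<open>j\<close> of the old layer extended by bit
  \<open>b\<close>.\<close>

primrec layer :: "nat \<Rightarrow> int \<Rightarrow> int \<times> int" where
  "layer 0 = (\<lambda>j. if j = 0 then (1, 1) else (0, 0))"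
| "layer (Suc i) = (let
    u = (\<lambda>(j, b). fst (layer i j) * \<alpha> i b); v = (\<lambda>(j, b). snd (layer i j) * \<beta> i b);
    A = (\<lambda>k. {a \<in> {-B..B} \<times> UNIV. bucket (u a) (v a) = k})
    in (\<lambda>k. (sum u (A k), sum v (A k))))"

definition massP :: "nat \<Rightarrow> int \<Rightarrow> int" where "massP i j = fst (layer i j)"
definition massQ :: "nat \<Rightarrow> int \<Rightarrow> int" where "massQ i j = snd (layer i j)"
definition atomP :: "nat \<Rightarrow> int \<times> bool \<Rightarrow> int" where "atomP i = (\<lambda>(j, b). massP i j * \<alpha> i b)"
definition atomQ :: "nat \<Rightarrow> int \<times> bool \<Rightarrow> int" where "atomQ i = (\<lambda>(j, b). massQ i j * \<beta> i b)"
definition atom_indices :: "(int \<times> bool) set" where "atom_indices = {-B..B} \<times> UNIV"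

lemma finite_atom_indices [simp]: "finite atom_indices" by (simp add: atom_indices_def)

lemma massP_0: "massP 0 j = of_bool (j = 0)" and massQ_0: "massQ 0 j = of_bool (j = 0)"
  by (simp_all add: massP_def massQ_def)

lemma massP_Suc: "massP (Suc i) k = sum (atomP i) {a \<in> atom_indices. bucket (atomP i a) (atomQ i a) = k}"
  and massQ_Suc: "massQ (Suc i) k = sum (atomQ i) {a \<in> atom_indices. bucket (atomP i a) (atomQ i a) = k}"
  by (simp_all add: massP_def massQ_def atomP_def atomQ_def atom_indices_def Let_def case_prod_unfold)

lemma M_pos: "0 < M" unfolding M_def by (intro prod_pos) (auto simp: D_pos)

lemma B_nonneg: "0 \<le> B" unfolding B_def using N_pos M_pos by (intro scale_index_nonneg) auto

lemma scale_argument: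
  assumes "0 \<le> d" "d \<le> M" "0 \<le> y"
  shows "0 \<le> d * M * N div y" "d * M * N div y \<le> M * M * N" "d * M * N \<le> M * M * N"
proof -
  have nn: "0 \<le> d * M * N" using assms M_pos N_pos by simp
  have "d * M * N div y \<le> d * M * N"
  proof (cases "y = 0")
    case False
    then show ?thesis using zdiv_mono2[OF nn, of 1 y] assms by simp
  qed (simp add: nn)
  also show le: "d * M * N \<le> M * M * N" using assms M_pos N_pos by (simp add: mult_right_mono)
  finally show "d * M * N div y \<le> M * M * N" .
  show "0 \<le> d * M * N div y"
    using nn assms(3) by (cases "y = 0") (simp_all add: pos_imp_zdiv_nonneg_iff)
qed

lemma scale_index_le_B:
  assumes "0 \<le> d" "d \<le> M" "0 \<le> y"
  shows "scale_index N (d * M * N div y) \<le> B"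
  unfolding B_def by (intro scale_index_mono N_pos scale_argument assms)

lemma bucket_bound:
  assumes "0 \<le> x" "0 \<le> y" "x \<le> M" "y \<le> M"
  shows "bucket x y \<in> {-B..B}"
  using assms B_nonneg scale_index_le_B[of "x - y" y] scale_index_le_B[of "y - x" y]
    scale_index_nonneg[OF N_pos scale_argument(1)[of "x - y" y]]
    scale_index_nonneg[OF N_pos scale_argument(1)[of "y - x" y]]
  by (auto simp: bucket_def)

text \<open>Equal buckets force equal signs of the difference, because a nonzero difference has a
  positive index. The scaled ratios then have the same index, and
  \<open>scale_index_eq_close\<close> applies; the common scale \<open>M * N\<close> cancels. The
  claim is cleared of denominators to match the hypothesis of \<open>tail_merge\<close>.\<close>

lemma bucket_eq_close:
  assumes pos: "0 < y" "0 < y'" and le: "y \<le> M" "y' \<le> M"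
    and eq: "bucket x y = bucket x' y'"
  shows "\<bar>real_of_int x * of_int y' - of_int x' * of_int y\<bar>
    \<le> 1 / of_int N * \<bar>of_int x - of_int y\<bar> * of_int y'"
proof -
  define w where "w = (\<lambda>d y :: int. real_of_int (d * M * N) / of_int y)"
  have div: "d * M * N div y = \<lfloor>w d y\<rfloor>" for d y
    by (simp only: w_def floor_divide_of_int_eq)
  \<comment> \<open>The factor \<open>M\<close> in \<open>bucket\<close> makes the argument of \<open>scale_index\<close> at least \<open>N\<close>, since \<open>y \<le> M\<close>.\<close>
  have ge: "N \<le> \<lfloor>w d y\<rfloor>" if "0 < d" "0 < y" "y \<le> M" for d y
  proof -
    have "y \<le> 1 * M" "1 * M \<le> d * M" using that M_pos by (auto intro: mult_right_mono)
    then have "y \<le> d * M" by linarith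
    then have "y * N \<le> d * M * N" using N_pos by (intro mult_right_mono) auto
    then have "of_int N \<le> w d y" using that
      unfolding w_def by (simp only: pos_le_divide_eq of_int_0_less_iff of_int_mult[symmetric] of_int_le_iff mult.commute)
    then show ?thesis by linarith
  qed
  have key: "\<bar>real_of_int d * of_int y' - of_int d' * of_int y\<bar> \<le> 1 / of_int N * of_int d * of_int y'"
    if d: "0 < d" "0 < d'" and e: "scale_index N \<lfloor>w d y\<rfloor> = scale_index N \<lfloor>w d' y'\<rfloor>" for d d'
  proof -
    define c where "c = real_of_int (M * N)"
    have c: "0 < c" using M_pos N_pos by (simp add: c_def)
    have w: "w d y = c * (d / y)" for d y by (simp add: w_def c_def)
    have "\<bar>w d y - w d' y'\<bar> \<le> w d y / of_int N"
      using ge[of d y] ge[of d' y'] d pos le N_pos e by (intro scale_index_eq_close) auto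
    then have "c * \<bar>d / y - d' / y'\<bar> \<le> c * (d / y / of_int N)"
      unfolding w right_diff_distrib[symmetric] times_divide_eq_right[symmetric] abs_mult using c by simp
    then have "\<bar>d / y - d' / y'\<bar> \<le> d / y / of_int N" using c by (simp only: mult_le_cancel_left_pos)
    then have "\<bar>d / y - d' / y'\<bar> * (y * y') \<le> d / y / of_int N * (y * y')"
      using pos by (intro mult_right_mono) auto
    moreover have "\<bar>d / y - d' / y'\<bar> * (y * y') = \<bar>(d / y - d' / y') * (y * y')\<bar>"
      using pos by (simp add: abs_mult)
    moreover have "(d / y - d' / y') * (y * y') = real_of_int d * of_int y' - of_int d' * of_int y"
      using pos by (simp add: field_simps)
    moreover have "d / y / of_int N * (y * y') = 1 / of_int N * of_int d * of_int y'"
      using pos by (simp add: field_simps)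
    ultimately show ?thesis by simp
  qed
  have sp: "0 < scale_index N \<lfloor>w d y\<rfloor>" if "0 < d" "0 < y" "y \<le> M" for d y
    by (rule scale_index_pos[OF N_pos less_le_trans[OF N_pos ge[OF that]]])
  have z: "scale_index N \<lfloor>w 0 y\<rfloor> = 0" for y using N_pos by (simp add: w_def scale_index_less)
  have b: "bucket x y = (if x < y then - scale_index N \<lfloor>w (y - x) y\<rfloor> else scale_index N \<lfloor>w (x - y) y\<rfloor>)" for x y
    by (simp add: bucket_def div)
  have sgn: "sgn (bucket x y) = sgn (x - y)" if "0 < y" "y \<le> M" for x y
    using sp[of "y - x" y] sp[of "x - y" y] that z
    by (cases x y rule: linorder_cases) (auto simp: b)
  have s: "sgn (x - y) = sgn (x' - y')" using sgn[OF pos(1) le(1), of x] sgn[OF pos(2) le(2), of x'] eq by simp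
  consider "x < y" "x' < y'" | "x = y" "x' = y'" | "y < x" "y' < x'"
    using s by (cases x y rule: linorder_cases; cases x' y' rule: linorder_cases) auto
  \<comment> \<open>The products \<open>y * y'\<close> cancel: \<open>x * y' - x' * y\<close> equals
    \<open>(x - y) * y' - (x' - y') * y\<close>. So closeness of the differences is closeness of the
    masses.\<close>
  then show ?thesis
  proof cases
    case 1
    then show ?thesis using key[of "y - x" "y' - x'"] eq by (simp add: b algebra_simps)
  next
    case 2
    then show ?thesis by simp
  next
    case 3
    then show ?thesis using key[of "x - y" "x' - y'"] eq by (simp add: b algebra_simps)
  qed
qed

section \<open>Conservation of mass and the error of a round\<close>

definition total :: "nat \<Rightarrow> int" where "total i = (\<Prod>l<i. D l)"

lemma total_Suc: "total (Suc i) = total i * D i" by (simp add: total_def)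

lemma total_pos: "i \<le> n \<Longrightarrow> 0 < total i"
  unfolding total_def by (intro prod_pos) (auto simp: D_pos)

lemma total_le: "i \<le> n \<Longrightarrow> total i \<le> M"
proof -
  assume "i \<le> n"
  have "total i * 1 \<le> total i * (\<Prod>l\<in>{i..<n}. D l)"
  proof (rule mult_left_mono)
    show "1 \<le> (\<Prod>l\<in>{i..<n}. D l)" using D_pos by (intro prod_ge_1) fastforce
    show "0 \<le> total i" unfolding total_def by (intro prod_nonneg) (simp add: D_nonneg)
  qed
  also have "\<dots> = M"
    unfolding total_def M_def using \<open>i \<le> n\<close> by (simp add: lessThan_atLeast0 prod.atLeastLessThan_concat)
  finally show ?thesis by simp
qed

lemma sum_atom_indices: "sum f atom_indices = (\<Sum>j\<in>{-B..B}. f (j, False) + f (j, True))"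
  by (simp add: atom_indices_def sum.cartesian_product' UNIV_bool add.commute)

text \<open>The implication from \<open>massQ\<close> to \<open>massP\<close> is absolute continuity
  of P with respect to Q; it passes to the atoms because every \<open>\<beta> i b\<close> with
  \<open>i < n\<close> is positive. It ensures that the default value of division by 0 concerns
  empty atoms only.\<close>

definition layer_ok :: "nat \<Rightarrow> bool" where
  "layer_ok i \<longleftrightarrow> (\<forall>j. 0 \<le> massP i j \<and> 0 \<le> massQ i j \<and> (massQ i j = 0 \<longrightarrow> massP i j = 0)) \<and>
    sum (massP i) {-B..B} = total i \<and> sum (massQ i) {-B..B} = total i"

lemma atoms:
  assumes "layer_ok i" "i < n"
  shows "0 \<le> atomP i a" "0 \<le> atomQ i a" "atomQ i a = 0 \<Longrightarrow> atomP i a = 0"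
    "sum (atomP i) atom_indices = total (Suc i)" "sum (atomQ i) atom_indices = total (Suc i)"
    "a \<in> atom_indices \<Longrightarrow> atomP i a \<le> total (Suc i)" "a \<in> atom_indices \<Longrightarrow> atomQ i a \<le> total (Suc i)"
proof -
  show nn: "0 \<le> atomP i a" "0 \<le> atomQ i a" "atomQ i a = 0 \<Longrightarrow> atomP i a = 0" for a
    using assms \<alpha>_nonneg \<beta>_nonneg \<beta>_pos[of i]
    by (auto simp: atomP_def atomQ_def layer_ok_def less_imp_neq[THEN not_sym] split: prod.splits)
  show s: "sum (atomP i) atom_indices = total (Suc i)" "sum (atomQ i) atom_indices = total (Suc i)"
    using assms unfolding sum_atom_indices atomP_def atomQ_def
    by (simp_all add: distrib_left[symmetric] \<alpha>_sum \<beta>_sum sum_distrib_right[symmetric] layer_ok_def total_Suc)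
  show "a \<in> atom_indices \<Longrightarrow> atomP i a \<le> total (Suc i)" "a \<in> atom_indices \<Longrightarrow> atomQ i a \<le> total (Suc i)"
    using member_le_sum[of a atom_indices "atomP i"] member_le_sum[of a atom_indices "atomQ i"] nn s by auto
qed

lemma bucket_in:
  assumes "layer_ok i" "i < n" "a \<in> atom_indices"
  shows "bucket (atomP i a) (atomQ i a) \<in> {-B..B}"
  using atoms(1,2,6,7)[OF assms(1,2), of a] assms total_le[of "Suc i"] by (intro bucket_bound) auto

lemma sum_mass_0: "sum (massP 0) {-B..B} = 1" "sum (massQ 0) {-B..B} = 1"
  using B_nonneg by (simp_all add: massP_0 massQ_0 of_bool_def sum.delta)

text \<open>All atoms land in \<open>{-B..B}\<close>, so regrouping them by bucket loses no mass. A
  bucket of Q-mass 0 collects only atoms of Q-mass 0, whose P-mass is 0 as well.\<close>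

lemma layer_ok: "i \<le> n \<Longrightarrow> layer_ok i"
proof (induction i)
  case 0
  then show ?case using sum_mass_0 by (simp add: layer_ok_def massP_0 massQ_0 total_def)
next
  case (Suc i)
  then have ok: "layer_ok i" and i: "i < n" by auto
  note at = atoms[OF ok i]
  have img: "(\<lambda>a. bucket (atomP i a) (atomQ i a)) ` atom_indices \<subseteq> {-B..B}" using bucket_in[OF ok i] by auto
  have "massQ (Suc i) k = 0 \<Longrightarrow> massP (Suc i) k = 0" for k
    using at(3) by (auto simp: massP_Suc massQ_Suc sum_nonneg_eq_0_iff at(2) intro!: sum.neutral)
  moreover have "sum (massP (Suc i)) {-B..B} = sum (atomP i) atom_indices" "sum (massQ (Suc i)) {-B..B} = sum (atomQ i) atom_indices"
    using sum.group[OF finite_atom_indices _ img, of "atomP i"] sum.group[OF finite_atom_indices _ img, of "atomQ i"]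
    by (simp_all add: massP_Suc massQ_Suc)
  ultimately show ?case using at by (auto simp: layer_ok_def massP_Suc massQ_Suc intro!: sum_nonneg)
qed

text \<open>\<open>M\<close> times the value obtained if merging stopped after \<open>i\<close>
  coordinates and the remaining ones were treated exactly. It interpolates between the true distance
  and the output, both scaled by \<open>M\<close>.\<close>

definition potential :: "nat \<Rightarrow> real" where
  "potential i = (\<Sum>j\<in>{-B..B}. tail (n - i) i (of_int (massP i j)) (of_int (massQ i j)))"

lemma potential_0: "potential 0 = tail n 0 1 1"
proof -
  have "potential 0 = (\<Sum>j\<in>{-B..B}. if j = 0 then tail n 0 1 1 else 0)"
    unfolding potential_def by (intro sum.cong) (auto simp: massP_0 massQ_0)
  then show ?thesis using B_nonneg by (simp add: sum.delta)
qed

text \<open>Splitting buckets into atoms is exact, so the whole change of the potential comes from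
  merging.\<close>

lemma potential_atoms:
  assumes "i < n"
  shows "potential i = (\<Sum>a\<in>atom_indices. tail (n - Suc i) (Suc i) (of_int (atomP i a)) (of_int (atomQ i a)))"
proof -
  have "n - i = Suc (n - Suc i)" using assms by simp
  then show ?thesis unfolding potential_def sum_atom_indices by (simp add: UNIV_bool atomP_def atomQ_def add.commute)
qed

text \<open>The first bound is subadditivity on each bucket. The second applies
  \<open>tail_merge\<close> with \<open>\<eta> = 1 / N\<close> to each bucket and then compares the
  sum of \<open>|u - v|\<close> with the potential, using that \<open>|t|\<close> is
  \<open>2 * max 0 t - t\<close>.\<close>

lemma potential_step:
  assumes "i < n"
  shows "potential (Suc i) \<le> potential i"
    and "potential i - potential (Suc i) \<le> 2 / of_int N * potential i"
proof -
  note ok = layer_ok[OF less_imp_le[OF assms]]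
  note at = atoms[OF ok assms]
  define m where "m = n - Suc i"
  define G where "G = (\<lambda>k. {a \<in> atom_indices. bucket (atomP i a) (atomQ i a) = k})"
  define f where "f = (\<lambda>a. tail m (Suc i) (of_int (atomP i a)) (of_int (atomQ i a)))"
  define g where "g = (\<lambda>k. tail m (Suc i) (of_int (massP (Suc i) k)) (of_int (massQ (Suc i) k)))"
  define h where "h = (\<lambda>a. \<bar>real_of_int (atomP i a) - of_int (atomQ i a)\<bar>)"
  define r where "r = R m (Suc i)"
  have g: "g k = tail m (Suc i) (\<Sum>a\<in>G k. of_int (atomP i a)) (\<Sum>a\<in>G k. of_int (atomQ i a))" for k
    by (simp add: g_def massP_Suc massQ_Suc G_def)
  have pS: "potential (Suc i) = sum g {-B..B}" by (simp add: potential_def g_def m_def)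
  have group: "sum q atom_indices = (\<Sum>k\<in>{-B..B}. sum q (G k))" for q :: "_ \<Rightarrow> real"
    unfolding G_def using bucket_in[OF ok assms] by (intro sum.group[symmetric]) auto
  have p: "potential i = (\<Sum>k\<in>{-B..B}. sum f (G k))"
    using potential_atoms[OF assms] group[of f] by (simp add: f_def m_def)
  show "potential (Suc i) \<le> potential i"
    unfolding pS p g f_def by (intro sum_mono tail_sum_le)
  have "sum f (G k) - g k \<le> 1 / of_int N * r * sum h (G k)" for k
    unfolding g f_def h_def r_def
  proof (rule tail_merge)
    fix a c assume ac: "a \<in> G k" "c \<in> G k"
    show "\<bar>real_of_int (atomP i a) * of_int (atomQ i c) - of_int (atomP i c) * of_int (atomQ i a)\<bar>
      \<le> 1 / of_int N * \<bar>of_int (atomP i a) - of_int (atomQ i a)\<bar> * of_int (atomQ i c)"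
    \<comment> \<open>Empty atoms share bucket 0 with the atoms of equal masses, where no ratio is
      available. If either atom is empty, both sides are 0.\<close>
    proof (cases "atomQ i a = 0 \<or> atomQ i c = 0")
      case True
      then show ?thesis using at(3)[of a] at(3)[of c] at(2)[of c] N_pos by auto
    next
      case False
      then have "0 < atomQ i a" "0 < atomQ i c" using at(2) by (metis order_le_less)+
      moreover have "atomQ i a \<le> M" "atomQ i c \<le> M"
        using ac at(7)[of a] at(7)[of c] total_le[of "Suc i"] assms by (simp_all add: G_def)
      ultimately show ?thesis using ac by (intro bucket_eq_close) (auto simp: G_def)
    qed
  qed (use at in \<open>auto simp: G_def\<close>)
  then have "potential i - potential (Suc i) \<le> (\<Sum>k\<in>{-B..B}. 1 / of_int N * r * sum h (G k))"
    unfolding pS p sum_subtractf[symmetric] by (rule sum_mono)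
  also have "\<dots> = 1 / of_int N * (r * sum h atom_indices)" by (simp add: group[of h] sum_distrib_left mult.assoc)
  also have "\<dots> \<le> 1 / of_int N * (2 * potential i)"
  proof (rule mult_left_mono)
    \<comment> \<open>The last term sums to 0 over all atoms, since both total masses agree.\<close>
    have "r * h a \<le> 2 * f a - r * (of_int (atomP i a) - of_int (atomQ i a))" for a
      using tail_ge[of "atomP i a" "atomQ i a" m "Suc i"] tail_nonneg[of m "Suc i" "atomP i a" "atomQ i a"]
      by (auto simp: h_def f_def r_def abs_if algebra_simps)
    then have "(\<Sum>a\<in>atom_indices. r * h a) \<le> (\<Sum>a\<in>atom_indices. 2 * f a - r * (of_int (atomP i a) - of_int (atomQ i a)))"
      by (rule sum_mono)
    also have "\<dots> = 2 * sum f atom_indices - r * (of_int (sum (atomP i) atom_indices) - of_int (sum (atomQ i) atom_indices))"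
      by (simp add: sum_subtractf sum_distrib_left right_diff_distrib)
    also have "\<dots> = 2 * potential i" using at(4,5) group[of f] by (simp add: p)
    finally show "r * sum h atom_indices \<le> 2 * potential i" by (simp add: sum_distrib_left)
  qed (use N_pos in simp)
  finally show "potential i - potential (Suc i) \<le> 2 / of_int N * potential i" by simp
qed

text \<open>Since the potential never increases, every loss can be charged to its initial value. The
  losses therefore add up to \<open>2 * i / N\<close> instead of compounding.\<close>

lemma potential_bounds:
  "i \<le> n \<Longrightarrow> (1 - 2 * real i / of_int N) * tail n 0 1 1 \<le> potential i \<and> potential i \<le> tail n 0 1 1"
proof (induction i)
  case 0
  then show ?case by (simp add: potential_0)
next
  case (Suc i)
  have "2 / of_int N * potential i \<le> 2 / of_int N * tail n 0 1 1"
    using Suc N_pos by (intro mult_left_mono) auto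
  then show ?case
    using Suc potential_step[of i] by (simp add: add_divide_distrib algebra_simps)
qed

lemma potential_n: "potential n = of_int (\<Sum>j\<in>{-B..B}. max 0 (massP n j - massQ n j))"
  by (simp add: potential_def of_int_max)

end

section \<open>Cost-aware weakest preconditions\<close>

lemma bits_mono: "\<bar>k\<bar> \<le> \<bar>m\<bar> \<Longrightarrow> bits k \<le> bits m"
proof -
  assume "\<bar>k\<bar> \<le> \<bar>m\<bar>"
  also have "\<bar>m\<bar> < 2 ^ (bits m - 1)" by (simp add: bits_less_iff bits_def)
  finally show ?thesis by (simp add: bits_less_iff) (simp add: bits_def)
qed

text \<open>All intermediate values and addresses are bounded, not only the final value, since the
  logarithmic cost charges each of them.\<close>

primrec bounded :: "int \<Rightarrow> aexp \<Rightarrow> state \<Rightarrow> bool" where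
  "bounded X (Const k) s \<longleftrightarrow> \<bar>k\<bar> \<le> X"
| "bounded X (Var x) s \<longleftrightarrow> \<bar>ivar s x\<bar> \<le> X"
| "bounded X (Read a e) s \<longleftrightarrow> bounded X e s \<and> \<bar>iarr s a (aval e s)\<bar> \<le> X"
| "bounded X (Plus e1 e2) s \<longleftrightarrow> bounded X e1 s \<and> bounded X e2 s \<and> \<bar>aval e1 s + aval e2 s\<bar> \<le> X"
| "bounded X (Minus e1 e2) s \<longleftrightarrow> bounded X e1 s \<and> bounded X e2 s \<and> \<bar>aval e1 s - aval e2 s\<bar> \<le> X"
| "bounded X (Times e1 e2) s \<longleftrightarrow> bounded X e1 s \<and> bounded X e2 s \<and> \<bar>aval e1 s * aval e2 s\<bar> \<le> X"
| "bounded X (Quot e1 e2) s \<longleftrightarrow> bounded X e1 s \<and> bounded X e2 s \<and> \<bar>aval e1 s div aval e2 s\<bar> \<le> X"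

primrec bbounded :: "int \<Rightarrow> bexp \<Rightarrow> state \<Rightarrow> bool" where
  "bbounded X (Less e1 e2) s \<longleftrightarrow> bounded X e1 s \<and> bounded X e2 s"
| "bbounded X (Equal e1 e2) s \<longleftrightarrow> bounded X e1 s \<and> bounded X e2 s"
| "bbounded X (Neg b) s \<longleftrightarrow> bbounded X b s"
| "bbounded X (Conj b1 b2) s \<longleftrightarrow> bbounded X b1 s \<and> bbounded X b2 s"

text \<open>The cost in units of \<open>(bits X)\<^sup>2\<close>. Sums, differences and comparisons
  count 2 because they cost the sum of two bit lengths; products and quotients cost one product of
  bit lengths and count 1.\<close>

primrec asize :: "aexp \<Rightarrow> nat" where
  "asize (Const k) = 1"
| "asize (Var x) = 1"
| "asize (Read a e) = asize e + 1"
| "asize (Plus e1 e2) = asize e1 + asize e2 + 2"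
| "asize (Minus e1 e2) = asize e1 + asize e2 + 2"
| "asize (Times e1 e2) = asize e1 + asize e2 + 1"
| "asize (Quot e1 e2) = asize e1 + asize e2 + 1"

primrec bsize :: "bexp \<Rightarrow> nat" where
  "bsize (Less e1 e2) = asize e1 + asize e2 + 2"
| "bsize (Equal e1 e2) = asize e1 + asize e2 + 2"
| "bsize (Neg b) = bsize b + 1"
| "bsize (Conj b1 b2) = bsize b1 + bsize b2 + 1"

lemma bounded_aval: "bounded X e s \<Longrightarrow> \<bar>aval e s\<bar> \<le> X"
  by (cases e) auto

lemma bits_pos: "1 \<le> bits k" by (simp add: bits_def)

lemma bits_le_square:
  assumes "\<bar>k\<bar> \<le> X"
  shows "bits k \<le> (bits X)\<^sup>2"
proof -
  have "bits k \<le> bits X" using assms by (intro bits_mono) simp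
  also have "\<dots> \<le> (bits X)\<^sup>2" using bits_pos[of X] by (simp add: power2_eq_square)
  finally show ?thesis .
qed

lemma bits_mult_le_square:
  assumes "\<bar>k\<bar> \<le> X" "\<bar>m\<bar> \<le> X"
  shows "bits k * bits m \<le> (bits X)\<^sup>2"
  unfolding power2_eq_square using assms by (intro mult_le_mono bits_mono) auto

lemma one_le_bits: "1 \<le> (bits X)\<^sup>2" using bits_pos[of X] by simp

lemma acost_le: "bounded X e s \<Longrightarrow> acost e s \<le> asize e * (bits X)\<^sup>2"
proof (induction e)
  case (Plus e1 e2)
  then show ?case
    using bits_le_square[of "aval e1 s" X] bits_le_square[of "aval e2 s" X]
    by (simp add: bounded_aval algebra_simps)
next
  case (Minus e1 e2)
  then show ?case
    using bits_le_square[of "aval e1 s" X] bits_le_square[of "aval e2 s" X]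
    by (simp add: bounded_aval algebra_simps)
next
  case (Times e1 e2)
  then show ?case using bits_mult_le_square[of "aval e1 s" X "aval e2 s"]
    by (simp add: bounded_aval algebra_simps)
next
  case (Quot e1 e2)
  then show ?case using bits_mult_le_square[of "aval e1 s" X "aval e2 s"]
    by (simp add: bounded_aval algebra_simps)
next
  case (Read a e)
  then show ?case using bits_le_square[of "iarr s a (aval e s)" X] by (simp add: algebra_simps)
qed (auto simp: bits_le_square)

lemma bcost_le: "bbounded X b s \<Longrightarrow> bcost b s \<le> bsize b * (bits X)\<^sup>2"
proof (induction b)
  case (Less e1 e2)
  then show ?case
    using bits_le_square[of "aval e1 s" X] bits_le_square[of "aval e2 s" X]
      acost_le[of X e1 s] acost_le[of X e2 s]
    by (simp add: bounded_aval algebra_simps)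
next
  case (Equal e1 e2)
  then show ?case
    using bits_le_square[of "aval e1 s" X] bits_le_square[of "aval e2 s" X]
      acost_le[of X e1 s] acost_le[of X e2 s]
    by (simp add: bounded_aval algebra_simps)
next
  case (Neg b)
  then show ?case using one_le_bits[of X] by simp
next
  case (Conj b1 b2)
  then show ?case using one_le_bits[of X] by (simp add: algebra_simps)
qed

text \<open>
  The numbers \<open>a\<close> and \<open>a'\<close> count elapsed time in units of \<open>(bits X)\<^sup>2\<close>, which bounds the cost of an
  elementary operation on operands of absolute value at most \<open>X\<close>.
\<close>

definition wp :: "int \<Rightarrow> com \<Rightarrow> (nat \<Rightarrow> state \<Rightarrow> bool) \<Rightarrow> nat \<Rightarrow> state \<Rightarrow> bool" where
  "wp X c Q a s \<longleftrightarrow> (\<exists>t a' s'. (\<forall>\<omega>. exec c s \<omega> t s' \<omega>) \<and>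
    a * (bits X)\<^sup>2 + t \<le> a' * (bits X)\<^sup>2 \<and> Q a' s')"

lemma wpI:
  assumes "\<And>\<omega>. exec c s \<omega> t s' \<omega>" "t \<le> k * (bits X)\<^sup>2" "Q (a + k) s'"
  shows "wp X c Q a s"
  unfolding wp_def using assms by (intro exI[of _ t] exI[of _ "a + k"] exI[of _ s']) (simp add: algebra_simps)

lemma wp_Skip: "Q (a + 1) s \<Longrightarrow> wp X Skip Q a s"
  using exec_Skip one_le_bits by (intro wpI[where k = 1 and t = 1]) auto

lemma wp_Assign:
  assumes "bounded X e s" "Q (a + (1 + asize e)) (set_var x (aval e s) s)"
  shows "wp X (Assign x e) Q a s"
proof (rule wpI[where Q = Q, OF exec_Assign _ assms(2)])
  show "1 + acost e s \<le> (1 + asize e) * (bits X)\<^sup>2"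
    using acost_le[OF assms(1)] one_le_bits[of X] by (simp add: algebra_simps)
qed

lemma wp_Store:
  assumes "bounded X i s" "bounded X e s"
    "Q (a + (1 + asize i + asize e)) (set_arr x (aval i s) (aval e s) s)"
  shows "wp X (Store x i e) Q a s"
proof (rule wpI[where Q = Q, OF exec_Store _ assms(3)])
  show "1 + acost i s + acost e s \<le> (1 + asize i + asize e) * (bits X)\<^sup>2"
    using acost_le[OF assms(1)] acost_le[OF assms(2)] one_le_bits[of X] by (simp add: algebra_simps)
qed

lemma wp_Seq:
  assumes "wp X c1 (wp X c2 Q) a s"
  shows "wp X (Seq c1 c2) Q a s"
proof -
  from assms obtain t1 a1 s1 t2 a2 s2 where
    "\<And>\<omega>. exec c1 s \<omega> t1 s1 \<omega>" "a * (bits X)\<^sup>2 + t1 \<le> a1 * (bits X)\<^sup>2"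
    "\<And>\<omega>. exec c2 s1 \<omega> t2 s2 \<omega>" "a1 * (bits X)\<^sup>2 + t2 \<le> a2 * (bits X)\<^sup>2" "Q a2 s2"
    unfolding wp_def by blast
  then show ?thesis unfolding wp_def
    by (intro exI[of _ "t1 + t2"] exI[of _ a2] exI[of _ s2]) (auto intro: exec_Seq)
qed

lemma guard_le:
  assumes "bbounded X b s" "(a + (1 + bsize b)) * (bits X)\<^sup>2 + t \<le> a' * (bits X)\<^sup>2"
  shows "a * (bits X)\<^sup>2 + (1 + bcost b s + t) \<le> a' * (bits X)\<^sup>2"
proof -
  have "a * (bits X)\<^sup>2 + (1 + bcost b s + t) \<le> (a + (1 + bsize b)) * (bits X)\<^sup>2 + t"
    using bcost_le[OF assms(1)] one_le_bits[of X] by (simp add: algebra_simps)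
  with assms(2) show ?thesis by (rule order_trans[rotated])
qed

lemma wp_Cond:
  assumes "bbounded X b s"
    and "bval b s \<Longrightarrow> wp X c1 Q (a + (1 + bsize b)) s"
    and "\<not> bval b s \<Longrightarrow> wp X c2 Q (a + (1 + bsize b)) s"
  shows "wp X (Cond b c1 c2) Q a s"
proof (cases "bval b s")
  case True
  with assms(2) obtain t a' s' where
    "\<And>\<omega>. exec c1 s \<omega> t s' \<omega>" "(a + (1 + bsize b)) * (bits X)\<^sup>2 + t \<le> a' * (bits X)\<^sup>2" "Q a' s'"
    unfolding wp_def by blast
  with True guard_le[OF assms(1)] show ?thesis unfolding wp_def by (blast intro: exec_CondT)
next
  case False
  with assms(3) obtain t a' s' where
    "\<And>\<omega>. exec c2 s \<omega> t s' \<omega>" "(a + (1 + bsize b)) * (bits X)\<^sup>2 + t \<le> a' * (bits X)\<^sup>2" "Q a' s'"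
    unfolding wp_def by blast
  with False guard_le[OF assms(1)] show ?thesis unfolding wp_def by (blast intro: exec_CondF)
qed

lemma wp_While:
  assumes "bbounded X b s"
    and "bval b s \<Longrightarrow> wp X c (wp X (While b c) Q) (a + (1 + bsize b)) s"
    and "\<not> bval b s \<Longrightarrow> Q (a + (1 + bsize b)) s"
  shows "wp X (While b c) Q a s"
proof (cases "bval b s")
  case True
  with assms(2) obtain t1 a1 s1 t2 a2 s2 where
    1: "\<And>\<omega>. exec c s \<omega> t1 s1 \<omega>" "(a + (1 + bsize b)) * (bits X)\<^sup>2 + t1 \<le> a1 * (bits X)\<^sup>2" and
    2: "\<And>\<omega>. exec (While b c) s1 \<omega> t2 s2 \<omega>" "a1 * (bits X)\<^sup>2 + t2 \<le> a2 * (bits X)\<^sup>2" "Q a2 s2"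
    unfolding wp_def by blast
  have "exec (While b c) s \<omega> (1 + bcost b s + t1 + t2) s2 \<omega>" for \<omega>
    using True 1(1) 2(1) by (rule exec_WhileT)
  then show ?thesis unfolding wp_def using guard_le[OF assms(1) 1(2)] 2(2,3)
    by (intro exI[of _ "1 + bcost b s + t1 + t2"] exI[of _ a2] exI[of _ s2]) auto
next
  case False
  then show ?thesis
    using guard_le[OF assms(1), of a 0 "a + (1 + bsize b)"] assms(3) exec_WhileF[of b s c]
    unfolding wp_def by (intro exI[of _ "1 + bcost b s"] exI[of _ "a + (1 + bsize b)"] exI[of _ s]) auto
qed

lemma wp_weaken: "wp X c P a s \<Longrightarrow> (\<And>a s. P a s \<Longrightarrow> Q a s) \<Longrightarrow> wp X c Q a s"
  unfolding wp_def by blast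

text \<open>The number \<open>K\<close> of iterations is known in advance and \<open>m\<close>
  counts the completed ones, so the index replaces a variant, and \<open>I m\<close> can bound the
  elapsed time linearly in \<open>m\<close>.\<close>

lemma wp_loop:
  assumes "I 0 a s"
    and step: "\<And>m a s. m < K \<Longrightarrow> I m a s \<Longrightarrow>
      bbounded X b s \<and> bval b s \<and> wp X c (I (Suc m)) (a + (1 + bsize b)) s"
    and stop: "\<And>a s. I K a s \<Longrightarrow> bbounded X b s \<and> \<not> bval b s \<and> Q (a + (1 + bsize b)) s"
  shows "wp X (While b c) Q a s"
proof -
  have "wp X (While b c) Q a s" if "m \<le> K" "I m a s" for m a s
    using that
  proof (induction m arbitrary: a s rule: inc_induct)
    case base
    then show ?case using stop by (intro wp_While) auto
  next
    case (step m)
    then show ?case using assms(2)[of m a s] by (intro wp_While) (auto elim: wp_weaken)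
  qed
  then show ?thesis using assms(1) by blast
qed

lemma set_var_simps [simp]:
  "ivar (set_var x k s) y = (if y = x then k else ivar s y)"
  "iarr (set_var x k s) = iarr s"
  by (simp_all add: set_var_def)

lemma set_arr_simps [simp]:
  "ivar (set_arr a j k s) = ivar s"
  "iarr (set_arr a j k s) b = (if b = a then (iarr s a)(j := k) else iarr s b)"
  by (simp_all add: set_arr_def)

section \<open>The program\<close>

abbreviation Seq_infix :: "com \<Rightarrow> com \<Rightarrow> com" (infixr ";;" 60) where
  "c1 ;; c2 \<equiv> Seq c1 c2"

definition scale_loop :: com where
  "scale_loop = While (Neg (Less (Var ''z'') (Times (Const 2) (Var ''N''))))
    (Assign ''z'' (Quot (Var ''z'') (Const 2)) ;; Assign ''k'' (Plus (Var ''k'') (Var ''N'')))"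

definition scale_com :: com where
  "scale_com = Assign ''k'' (Const 0) ;; scale_loop ;; Assign ''k'' (Plus (Var ''k'') (Var ''z''))"

text \<open>Bucket 0 of the next layer has address \<open>o + W\<close>, and negative buckets lie to
  its left.\<close>

definition store_com :: com where
  "store_com =
    Assign ''k'' (Plus (Plus (Var ''o'') (Var ''W'')) (Var ''k'')) ;;
    Store ''P'' (Var ''k'') (Plus (Read ''P'' (Var ''k'')) (Var ''u'')) ;;
    Store ''Q'' (Var ''k'') (Plus (Read ''Q'' (Var ''k'')) (Var ''v''))"

definition add_com :: com where
  "add_com =
    Cond (Less (Var ''u'') (Var ''v''))
      (Assign ''z'' (Quot (Times (Times (Minus (Var ''v'') (Var ''u'')) (Var ''M'')) (Var ''N'')) (Var ''v'')))
      (Assign ''z'' (Quot (Times (Times (Minus (Var ''u'') (Var ''v'')) (Var ''M'')) (Var ''N'')) (Var ''v''))) ;;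
    scale_com ;;
    Cond (Less (Var ''u'') (Var ''v'')) (Assign ''k'' (Minus (Const 0) (Var ''k''))) Skip ;;
    store_com"

text \<open>Each weight is multiplied by the denominator of the other distribution, so that both
  distributions have the common denominator \<open>p_den * q_den\<close> at this coordinate.\<close>

definition weight_P :: "bool \<Rightarrow> aexp" where
  "weight_P b = (if b then Times (Read ''p_num'' (Var ''i'')) (Read ''q_den'' (Var ''i''))
    else Times (Minus (Read ''p_den'' (Var ''i'')) (Read ''p_num'' (Var ''i''))) (Read ''q_den'' (Var ''i'')))"

definition weight_Q :: "bool \<Rightarrow> aexp" where
  "weight_Q b = (if b then Times (Read ''q_num'' (Var ''i'')) (Read ''p_den'' (Var ''i''))
    else Times (Minus (Read ''q_den'' (Var ''i'')) (Read ''q_num'' (Var ''i''))) (Read ''p_den'' (Var ''i'')))"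

definition branch_com :: "bool \<Rightarrow> com" where
  "branch_com b =
    Assign ''u'' (Times (Read ''P'' (Plus (Var ''o'') (Var ''j''))) (weight_P b)) ;;
    Assign ''v'' (Times (Read ''Q'' (Plus (Var ''o'') (Var ''j''))) (weight_Q b)) ;;
    add_com"

definition incr :: "vname \<Rightarrow> com" where "incr x = Assign x (Plus (Var x) (Const 1))"

text \<open>Every layer gets its own row of width \<open>W\<close>. The buckets of the next layer
  are thus still 0 when atoms are added to them, and nothing has to be cleared.\<close>

definition layer_com :: com where
  "layer_com =
    Assign ''j'' (Minus (Const 0) (Var ''B'')) ;;
    While (Less (Var ''j'') (Plus (Var ''B'') (Const 1)))
      (branch_com False ;; branch_com True ;; incr ''j'') ;;
    Assign ''o'' (Plus (Var ''o'') (Var ''W'')) ;;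
    incr ''i''"

definition sum_com :: com where
  "sum_com =
    Assign ''out_num'' (Const 0) ;;
    Assign ''j'' (Minus (Const 0) (Var ''B'')) ;;
    While (Less (Var ''j'') (Plus (Var ''B'') (Const 1)))
      (Cond (Less (Read ''Q'' (Plus (Var ''o'') (Var ''j''))) (Read ''P'' (Plus (Var ''o'') (Var ''j''))))
        (Assign ''out_num'' (Plus (Var ''out_num'')
          (Minus (Read ''P'' (Plus (Var ''o'') (Var ''j''))) (Read ''Q'' (Plus (Var ''o'') (Var ''j''))))))
        Skip ;;
      incr ''j'')"

definition init_com :: com where
  "init_com =
    Assign ''M'' (Const 1) ;;
    Assign ''i'' (Const 0) ;;
    While (Less (Var ''i'') (Var ''n''))
      (Assign ''M'' (Times (Var ''M'') (Times (Read ''p_den'' (Var ''i'')) (Read ''q_den'' (Var ''i'')))) ;;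
      incr ''i'') ;;
    Assign ''N'' (Plus (Quot (Times (Times (Const 2) (Var ''n'')) (Var ''eps_den'')) (Var ''eps_num'')) (Const 1)) ;;
    Assign ''z'' (Times (Times (Var ''M'') (Var ''M'')) (Var ''N'')) ;;
    scale_com ;;
    Assign ''B'' (Var ''k'') ;;
    Assign ''W'' (Plus (Times (Const 2) (Var ''B'')) (Const 1)) ;;
    Store ''P'' (Const 0) (Const 1) ;;
    Store ''Q'' (Const 0) (Const 1) ;;
    Assign ''i'' (Const 0)"

definition tv_com :: com where
  "tv_com =
    init_com ;;
    While (Less (Var ''i'') (Var ''n'')) layer_com ;;
    sum_com ;;
    Assign ''out_den'' (Var ''M'')"

text \<open>Induction on \<open>L\<close>, which bounds the number of halvings. The sum
  \<open>k + scale_index N z\<close> is invariant, and it equals \<open>k + z\<close> once the loop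
  stops.\<close>

lemma wp_scale_loop:
  assumes "ivar s ''N'' = N" "0 < N" "2 * N \<le> X" "0 \<le> ivar s ''z''" "ivar s ''z'' < 2 ^ L" "ivar s ''z'' \<le> X"
    "0 \<le> ivar s ''k''" "ivar s ''k'' + scale_index N (ivar s ''z'') = S" "S \<le> X"
    and Q: "\<And>a' s'. a' \<le> a + 20 * L + 10 \<Longrightarrow> ivar s' ''k'' + ivar s' ''z'' = S \<Longrightarrow>
      0 \<le> ivar s' ''k'' \<Longrightarrow> 0 \<le> ivar s' ''z'' \<Longrightarrow>
      (\<forall>x. x \<notin> {''z'', ''k''} \<longrightarrow> ivar s' x = ivar s x) \<Longrightarrow> iarr s' = iarr s \<Longrightarrow> Q a' s'"
  shows "wp X scale_loop Q a s"
  using assms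
proof (induction L arbitrary: a s)
  case 0
  then show ?case unfolding scale_loop_def
    by (intro wp_While) (auto simp: scale_index_less)
next
  case (Suc L)
  have X2: "2 \<le> X" using Suc.prems(2,3) by linarith
  show ?case
  proof (cases "ivar s ''z'' < 2 * N")
    case True
    with Suc.prems X2 show ?thesis unfolding scale_loop_def
      by (intro wp_While) (auto simp: scale_index_less)
  next
    case False
    have S: "ivar s ''k'' + (N + scale_index N (ivar s ''z'' div 2)) = S"
      using Suc.prems False by (simp add: scale_index_ge)
    have nn: "0 \<le> scale_index N (ivar s ''z'' div 2)"
      using Suc.prems by (intro scale_index_nonneg) auto
    define s1 where "s1 = set_var ''k'' (ivar s ''k'' + N) (set_var ''z'' (ivar s ''z'' div 2) s)"
    \<comment> \<open>One round takes 17 units, 8 for the guard and 9 for the two assignments; the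
      claimed 20 per round leave slack.\<close>
    have "wp X scale_loop Q a1 s1" if "a1 \<le> a + 17" for a1
      using that S nn Suc.prems(2-7,9) by (intro Suc.IH Suc.prems(10)) (auto simp: s1_def Suc.prems(1))
    then have "wp X (Assign ''z'' (Quot (Var ''z'') (Const 2)) ;; Assign ''k'' (Plus (Var ''k'') (Var ''N'')))
      (wp X scale_loop Q) a1 s" if "a1 \<le> a + 8" for a1
      using that S nn Suc.prems False
      by (intro wp_Seq wp_Assign) (auto simp: s1_def add.assoc)
    then show ?thesis unfolding scale_loop_def
      using Suc.prems False by (intro wp_While) auto
  qed
qed

lemma wp_scale_com:
  assumes "ivar s ''N'' = N" "0 < N" "2 * N \<le> X" "0 \<le> ivar s ''z''" "ivar s ''z'' < 2 ^ L" "ivar s ''z'' \<le> X"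
    "scale_index N (ivar s ''z'') \<le> X"
    and Q: "\<And>a' s'. a' \<le> a + 20 * L + 20 \<Longrightarrow> ivar s' ''k'' = scale_index N (ivar s ''z'') \<Longrightarrow>
      (\<forall>x. x \<notin> {''z'', ''k''} \<longrightarrow> ivar s' x = ivar s x) \<Longrightarrow> iarr s' = iarr s \<Longrightarrow> Q a' s'"
  shows "wp X scale_com Q a s"
  unfolding scale_com_def
proof (intro wp_Seq wp_Assign)
  show "wp X scale_loop (wp X (Assign ''k'' (Plus (Var ''k'') (Var ''z''))) Q)
     (a + (1 + asize (Const 0))) (set_var ''k'' (aval (Const 0) s) s)" (is "wp X scale_loop ?Q ?a ?s")
  proof (rule wp_scale_loop[where S = "scale_index N (ivar s ''z'')" and N = N and L = L])
    fix a' and s' :: state assume *: "a' \<le> ?a + 20 * L + 10" "ivar s' ''k'' + ivar s' ''z'' = scale_index N (ivar s ''z'')"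
      "0 \<le> ivar s' ''k''" "0 \<le> ivar s' ''z''"
      "\<forall>x. x \<notin> {''z'', ''k''} \<longrightarrow> ivar s' x = ivar ?s x" "iarr s' = iarr ?s"
    show "?Q a' s'" by (intro wp_Assign Q) (use * assms in auto)
  qed (use assms in auto)
qed (use assms in auto)

text \<open>\<open>X\<close> has to dominate the masses, the largest argument
  \<open>M * M * N\<close> of the index, the comparison value \<open>2 * N\<close>, and the
  addresses of the \<open>n + 1\<close> rows of width \<open>2 * B + 1\<close>. \<open>L\<close>
  bounds the number of halvings.\<close>

locale weights_bound = weights +
  fixes X :: int and L :: nat
  assumes X: "4 \<le> X" "2 * (M * M * N) \<le> X" "(int n + 2) * (2 * B + 1) \<le> X"
    and L: "M * M * N < 2 ^ L"
begin

lemma M_le: "M \<le> M * M * N" and N_le: "N \<le> M * M * N"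
proof -
  have "M * 1 \<le> M * (M * N)" using M_pos N_pos by (intro mult_left_mono) (auto simp: int_one_le_iff_zero_less)
  then show "M \<le> M * M * N" by (simp add: mult.assoc)
  have "1 * N \<le> (M * M) * N" using M_pos N_pos by (intro mult_right_mono) (auto simp: int_one_le_iff_zero_less)
  then show "N \<le> M * M * N" by simp
qed

lemma B_le: "2 * (2 * B + 1) \<le> X"
proof -
  have "2 * (2 * B + 1) \<le> (int n + 2) * (2 * B + 1)" using B_nonneg by (intro mult_right_mono) auto
  with X(3) show ?thesis by linarith
qed

lemma address_le:
  assumes "i \<le> n"
  shows "0 \<le> int i * (2 * B + 1)" "int i * (2 * B + 1) + 2 * (2 * B + 1) \<le> X"
proof -
  have "(int i + 2) * (2 * B + 1) \<le> (int n + 2) * (2 * B + 1)"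
    using B_nonneg assms by (intro mult_right_mono) auto
  with X(3) show "int i * (2 * B + 1) + 2 * (2 * B + 1) \<le> X" by (simp add: algebra_simps)
qed (use B_nonneg in simp)

lemma wp_add_com:
  assumes vars: "ivar s ''N'' = N" "ivar s ''M'' = M" "ivar s ''o'' + ivar s ''W'' = r" "ivar s ''u'' = x" "ivar s ''v'' = y"
    and xy: "0 \<le> x" "x \<le> M" "0 \<le> y" "y \<le> M"
    and r: "\<bar>ivar s ''o''\<bar> \<le> X" "\<bar>ivar s ''W''\<bar> \<le> X" "B \<le> r" "r + B \<le> X"
    and arr: "0 \<le> iarr s ''P'' (r + bucket x y)" "iarr s ''P'' (r + bucket x y) + x \<le> M"
      "0 \<le> iarr s ''Q'' (r + bucket x y)" "iarr s ''Q'' (r + bucket x y) + y \<le> M"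
    and Q: "\<And>a' s'. a' \<le> a + 20 * L + 100 \<Longrightarrow>
      (\<forall>x. x \<notin> {''z'', ''k''} \<longrightarrow> ivar s' x = ivar s x) \<Longrightarrow>
      iarr s' = (iarr s)(''P'' := (iarr s ''P'')(r + bucket x y := iarr s ''P'' (r + bucket x y) + x),
        ''Q'' := (iarr s ''Q'')(r + bucket x y := iarr s ''Q'' (r + bucket x y) + y)) \<Longrightarrow> Q a' s'"
  shows "wp X add_com Q a s"
proof -
  have MX: "2 * M \<le> X" "2 * N \<le> X" using X(2) M_le N_le by linarith+
  \<comment> \<open>The absolute difference treats both branches of \<open>bucket\<close> at once;
    only the sign of \<open>k\<close> distinguishes them.\<close>
  define d where "d = \<bar>x - y\<bar>"
  have d: "0 \<le> d" "d \<le> M" using xy by (auto simp: d_def)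
  define t where "t = d * M * N div y"
  note sa = scale_argument[OF d xy(3), folded t_def]
  have dMN: "0 \<le> d * M * N" using d M_pos N_pos by simp
  have t: "0 \<le> t" "t \<le> X" "t < 2 ^ L" "\<bar>d * M * N\<bar> \<le> X"
    unfolding abs_of_nonneg[OF dMN] using sa X(2) L dMN by linarith+
  have "d * M * 1 \<le> d * M * N" using d M_pos N_pos by (intro mult_left_mono) auto
  moreover have dM0: "0 \<le> d * M" using d M_pos by simp
  ultimately have dM: "\<bar>d * M\<bar> \<le> X"
    unfolding abs_of_nonneg[OF dM0] using sa(3) X(2) dMN by linarith
  have si: "0 \<le> scale_index N t" "scale_index N t \<le> B"
    using scale_index_nonneg[OF N_pos t(1)] scale_index_le_B[OF d xy(3)] by (simp_all add: t_def)
  have bk: "bucket x y = (if x < y then - scale_index N t else scale_index N t)"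
    by (simp add: bucket_def t_def d_def)
  have bX: "\<bar>bucket x y\<bar> \<le> X" "\<bar>r + bucket x y\<bar> \<le> X" "\<bar>r\<bar> \<le> X"
    using si r B_nonneg B_le by (auto simp: bk)
  have lt: "d = y - x" if "x < y" using that by (simp add: d_def)
  have ge: "d = x - y" if "\<not> x < y" using that by (simp add: d_def)
  let ?tail = "Cond (Less (Var ''u'') (Var ''v'')) (Assign ''k'' (Minus (Const 0) (Var ''k''))) Skip ;;
    store_com"
  have rest: "wp X ?tail Q a1 s1"
    if a1: "a1 \<le> a + 20 * L + 40" and k1: "ivar s1 ''k'' = scale_index N t"
      and fr: "\<forall>x. x \<notin> {''z'', ''k''} \<longrightarrow> ivar s1 x = ivar s x" and ar: "iarr s1 = iarr s" for a1 s1
  proof -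
    have v1: "ivar s1 ''u'' = x" "ivar s1 ''v'' = y" "ivar s1 ''o'' = ivar s ''o''" "ivar s1 ''W'' = ivar s ''W''"
      using fr vars by simp_all
    have "wp X store_com Q a2 (set_var ''k'' (bucket x y) s1)" if "a2 \<le> a1 + 20" for a2
      unfolding store_com_def by (intro wp_Seq wp_Assign wp_Store Q)
        (use that a1 fr ar v1 vars(3) r bX xy MX arr in \<open>auto simp: fun_eq_iff\<close>)
    moreover have "wp X store_com Q a2 s1" if "a2 \<le> a1 + 20" "ivar s1 ''k'' = bucket x y" for a2
      unfolding store_com_def by (intro wp_Seq wp_Assign wp_Store Q)
        (use that a1 fr ar v1 vars(3) r bX xy MX arr in \<open>auto simp: fun_eq_iff\<close>)
    ultimately show ?thesis
      by (intro wp_Seq wp_Cond wp_Assign wp_Skip)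
        (use k1 v1 xy MX bX X(1) si in \<open>auto simp: bk\<close>)
  qed
  have "wp X (scale_com ;; ?tail) Q a1 (set_var ''z'' t s)" if "a1 \<le> a + 20" for a1
  proof (rule wp_Seq, rule wp_scale_com[where N = N and L = L])
    fix a' and s' :: state assume "a' \<le> a1 + 20 * L + 20" "ivar s' ''k'' = scale_index N (ivar (set_var ''z'' t s) ''z'')"
      "\<forall>x. x \<notin> {''z'', ''k''} \<longrightarrow> ivar s' x = ivar (set_var ''z'' t s) x" "iarr s' = iarr (set_var ''z'' t s)"
    with that show "wp X ?tail Q a' s'" by (intro rest) auto
  qed (use vars N_pos MX t si B_le B_nonneg in auto)
  then show ?thesis unfolding add_com_def
    by (intro wp_Seq[of X "Cond _ _ _"] wp_Cond wp_Assign)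
      (use vars xy MX dM t lt ge N_pos in \<open>auto simp: t_def\<close>)
qed

section \<open>Partially filled rows in memory\<close>

abbreviation width :: int where "width \<equiv> 2 * B + 1"

text \<open>The content of bucket \<open>k\<close> of the next layer when exactly the atoms in
  \<open>S\<close> have been distributed. For \<open>S = atom_indices\<close> it is
  \<open>massP (Suc i) k\<close>.\<close>

definition partP :: "nat \<Rightarrow> (int \<times> bool) set \<Rightarrow> int \<Rightarrow> int" where
  "partP i S k = sum (atomP i) {a \<in> S. bucket (atomP i a) (atomQ i a) = k}"

definition partQ :: "nat \<Rightarrow> (int \<times> bool) set \<Rightarrow> int \<Rightarrow> int" where
  "partQ i S k = sum (atomQ i) {a \<in> S. bucket (atomP i a) (atomQ i a) = k}"

lemma part_empty [simp]: "partP i {} k = 0" "partQ i {} k = 0"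
  by (simp_all add: partP_def partQ_def)

lemma part_insert:
  assumes "finite S" "a \<notin> S"
  shows "partP i (insert a S) k = partP i S k + (if bucket (atomP i a) (atomQ i a) = k then atomP i a else 0)"
    and "partQ i (insert a S) k = partQ i S k + (if bucket (atomP i a) (atomQ i a) = k then atomQ i a else 0)"
proof -
  have "{x \<in> insert a S. bucket (atomP i x) (atomQ i x) = k} =
      (if bucket (atomP i a) (atomQ i a) = k then insert a {x \<in> S. bucket (atomP i x) (atomQ i x) = k}
       else {x \<in> S. bucket (atomP i x) (atomQ i x) = k})" by auto
  then show "partP i (insert a S) k = partP i S k + (if bucket (atomP i a) (atomQ i a) = k then atomP i a else 0)"
    "partQ i (insert a S) k = partQ i S k + (if bucket (atomP i a) (atomQ i a) = k then atomQ i a else 0)"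
    using assms by (simp_all add: partP_def partQ_def)
qed

text \<open>With the atom about to be stored included, the bucket still holds a partial sum of
  nonnegative masses with total at most \<open>M\<close>. This bounds the number written by
  \<open>store_com\<close>.\<close>

lemma part_bounds:
  assumes "i < n" "S \<subseteq> atom_indices" "a \<in> atom_indices" "a \<notin> S"
  shows "0 \<le> partP i S k" "partP i S k + atomP i a \<le> M"
    and "0 \<le> partQ i S k" "partQ i S k + atomQ i a \<le> M"
proof -
  note at = atoms[OF layer_ok[OF less_imp_le[OF assms(1)]] assms(1)]
  have fin: "finite S" by (rule finite_subset[OF assms(2) finite_atom_indices])
  show "0 \<le> partP i S k" "0 \<le> partQ i S k"
    unfolding partP_def partQ_def using at by (auto intro: sum_nonneg)
  have le: "sum f {a \<in> S. bucket (atomP i a) (atomQ i a) = k} + f a \<le> sum f atom_indices"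
    if f: "\<And>a. 0 \<le> f a" for f :: "int \<times> bool \<Rightarrow> int"
  proof -
    have "sum f {a \<in> S. bucket (atomP i a) (atomQ i a) = k} + f a
        = sum f (insert a {a \<in> S. bucket (atomP i a) (atomQ i a) = k})"
      using fin assms(4) by simp
    also have "\<dots> \<le> sum f atom_indices" using assms by (intro sum_mono2 f) auto
    finally show ?thesis .
  qed
  show "partP i S k + atomP i a \<le> M" "partQ i S k + atomQ i a \<le> M"
    unfolding partP_def partQ_def
    using le[of "atomP i"] le[of "atomQ i"] at total_le[of "Suc i"] assms(1) by fastforce+
qed

text \<open>
  Bucket \<open>j\<close> of layer \<open>i\<close> is stored at address \<open>i * width + j\<close>; the program variable \<open>o\<close> holds
  \<open>i * width\<close>. While layer \<open>i\<close> is scanned, the atoms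
  in \<open>S\<close> have already been distributed over the next row; the memory beyond it is still 0.
\<close>

definition rows :: "nat \<Rightarrow> (int \<times> bool) set \<Rightarrow> (int \<Rightarrow> int) \<Rightarrow> (int \<Rightarrow> int) \<Rightarrow> bool" where
  "rows i S p q \<longleftrightarrow>
    (\<forall>j\<in>{-B..B}. p (int i * width + j) = massP i j \<and> q (int i * width + j) = massQ i j) \<and>
    (\<forall>k\<in>{-B..B}. p (int i * width + width + k) = partP i S k \<and> q (int i * width + width + k) = partQ i S k) \<and>
    (\<forall>x. int i * width + width + B < x \<longrightarrow> p x = 0 \<and> q x = 0)"

lemma rows_0: "rows 0 {} ((\<lambda>_. 0)(0 := 1)) ((\<lambda>_. 0)(0 := 1))"
  using B_nonneg by (auto simp: rows_def massP_0 massQ_0)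

text \<open>A fully distributed row consists of the masses of the next layer, and the zeros beyond
  it serve as the empty partial sums of the row after that.\<close>

lemma rows_next:
  assumes "rows i atom_indices p q"
  shows "rows (Suc i) {} p q"
proof -
  have *: "int (Suc i) * width = int i * width + width" by (simp add: algebra_simps)
  show ?thesis unfolding rows_def *
  proof (intro conjI ballI allI impI)
    fix j assume "j \<in> {-B..B}"
    then show "p (int i * width + width + j) = massP (Suc i) j" "q (int i * width + width + j) = massQ (Suc i) j"
      using assms unfolding rows_def massP_Suc massQ_Suc partP_def[symmetric] partQ_def[symmetric] by blast+
  next
    fix k assume "k \<in> {-B..B}"
    then have "int i * width + width + B < int i * width + width + width + k" by auto
    then show "p (int i * width + width + width + k) = partP (Suc i) {} k"
      "q (int i * width + width + width + k) = partQ (Suc i) {} k"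
      using assms unfolding rows_def part_empty by blast+
  next
    fix x assume "int i * width + width + width + B < x"
    then have "int i * width + width + B < x" using B_nonneg by auto
    then show "p x = 0" "q x = 0" using assms unfolding rows_def by blast+
  qed
qed

lemma rows_insert:
  fixes i a
  defines "r \<equiv> int i * width + width + bucket (atomP i a) (atomQ i a)"
  assumes rows: "rows i S p q" and i: "i < n" and a: "a \<in> atom_indices" "a \<notin> S" and S: "S \<subseteq> atom_indices"
  shows "rows i (insert a S) (p(r := p r + atomP i a)) (q(r := q r + atomQ i a))"
proof -
  have fin: "finite S" by (rule finite_subset[OF S finite_atom_indices])
  have "bucket (atomP i a) (atomQ i a) \<in> {-B..B}"
    using bucket_in[OF layer_ok[OF less_imp_le[OF i]] i a(1)] .
  then have b: "-B \<le> bucket (atomP i a) (atomQ i a)" "bucket (atomP i a) (atomQ i a) \<le> B" by auto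
  have p: "p (int i * width + width + k) = partP i S k" "q (int i * width + width + k) = partQ i S k"
    if "k \<in> {-B..B}" for k using rows that unfolding rows_def by blast+
  show ?thesis unfolding rows_def
  proof (intro conjI ballI allI impI)
    fix j assume j: "j \<in> {-B..B}"
    \<comment> \<open>The current row ends at \<open>i * width + B\<close>, one cell before the next
      row begins at \<open>i * width + width - B\<close>, so the write does not touch it.\<close>
    then have "int i * width + j \<noteq> r" using b by (auto simp: r_def)
    then show "(p(r := p r + atomP i a)) (int i * width + j) = massP i j"
      "(q(r := q r + atomQ i a)) (int i * width + j) = massQ i j"
      using rows j unfolding rows_def by simp_all
  next
    fix k assume k: "k \<in> {-B..B}"
    show "(p(r := p r + atomP i a)) (int i * width + width + k) = partP i (insert a S) k"
      "(q(r := q r + atomQ i a)) (int i * width + width + k) = partQ i (insert a S) k"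
      using p k by (auto simp: part_insert[OF fin a(2)] r_def)
  next
    fix x assume x: "int i * width + width + B < x"
    then have "x \<noteq> r" using b by (auto simp: r_def)
    then show "(p(r := p r + atomP i a)) x = 0" "(q(r := q r + atomQ i a)) x = 0"
      using rows x unfolding rows_def by simp_all
  qed
qed

lemma n_le_X: "int n + 2 \<le> X"
proof -
  have "(int n + 2) * 1 \<le> (int n + 2) * width" using B_nonneg by (intro mult_left_mono) auto
  from order_trans[OF this X(3)] show ?thesis by simp
qed

lemma D_le_M: "i < n \<Longrightarrow> D i \<le> M"
proof -
  assume i: "i < n"
  have "1 * D i \<le> total i * D i" using i D_nonneg total_pos[of i] by (intro mult_right_mono) auto
  then show ?thesis using total_le[of "Suc i"] i by (simp add: total_Suc)
qed

lemma mass_bounds: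
  assumes "i \<le> n" "j \<in> {-B..B}"
  shows "0 \<le> massP i j" "massP i j \<le> M" "0 \<le> massQ i j" "massQ i j \<le> M"
proof -
  have ok: "layer_ok i" using layer_ok assms(1) .
  then show "0 \<le> massP i j" "0 \<le> massQ i j" by (auto simp: layer_ok_def)
  show "massP i j \<le> M" "massQ i j \<le> M"
    using member_le_sum[of j "{-B..B}" "massP i"] member_le_sum[of j "{-B..B}" "massQ i"]
      ok total_le[OF assms(1)] assms(2) by (auto simp: layer_ok_def)
qed

end

section \<open>Correctness and step count of the program\<close>

locale tv_program = weights_bound +
  fixes pn pd qn qd :: "int \<Rightarrow> int"
  assumes pn: "0 \<le> pn (int i)" "pn (int i) \<le> pd (int i)" and qn: "0 \<le> qn (int i)" "qn (int i) \<le> qd (int i)"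
    and \<alpha>: "\<alpha> i b = (if b then pn (int i) * qd (int i) else (pd (int i) - pn (int i)) * qd (int i))"
    and \<beta>: "\<beta> i b = (if b then qn (int i) * pd (int i) else (qd (int i) - qn (int i)) * pd (int i))"
begin

lemma D_eq: "D i = pd (int i) * qd (int i)"
  unfolding \<alpha>_sum[symmetric] by (simp add: \<alpha> algebra_simps)

lemma den_bounds:
  assumes "i < n"
  shows "0 < pd (int i)" "pd (int i) \<le> M" "0 < qd (int i)" "qd (int i) \<le> M"
proof -
  have "pd (int i) * qd (int i) > 0" using D_pos[OF assms] by (simp add: D_eq)
  then show *: "0 < pd (int i)" "0 < qd (int i)"
    using pn[of i] qn[of i] by (auto simp: zero_less_mult_iff)
  have "pd (int i) * 1 \<le> pd (int i) * qd (int i)" "1 * qd (int i) \<le> pd (int i) * qd (int i)"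
    using * by (auto intro!: mult_left_mono mult_right_mono)
  then show "pd (int i) \<le> M" "qd (int i) \<le> M" using D_le_M[OF assms] by (auto simp: D_eq)
qed

definition params :: "state \<Rightarrow> bool" where
  "params s \<longleftrightarrow> ivar s ''n'' = int n \<and> ivar s ''M'' = M \<and> ivar s ''N'' = N \<and>
    ivar s ''B'' = B \<and> ivar s ''W'' = width \<and>
    iarr s ''p_num'' = pn \<and> iarr s ''p_den'' = pd \<and> iarr s ''q_num'' = qn \<and> iarr s ''q_den'' = qd"

lemma weight_le_D: "i < n \<Longrightarrow> 0 \<le> \<alpha> i b \<and> \<alpha> i b \<le> D i" "i < n \<Longrightarrow> 0 \<le> \<beta> i b \<and> \<beta> i b \<le> D i"
  using \<alpha>_nonneg[of i True] \<alpha>_nonneg[of i False] \<beta>_nonneg[of i True] \<beta>_nonneg[of i False]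
    \<alpha>_sum[of i] \<beta>_sum[of i] by (cases b; simp)+

lemma M_le_X: "2 * M \<le> X" "2 * N \<le> X"
  using X(2) M_le N_le by linarith+

lemma weight_aval:
  assumes "params s" "ivar s ''i'' = int i" "i < n"
  shows "aval (weight_P b) s = \<alpha> i b" "aval (weight_Q b) s = \<beta> i b"
    "bounded X (weight_P b) s" "bounded X (weight_Q b) s" "asize (weight_P b) \<le> 9" "asize (weight_Q b) \<le> 9"
proof -
  show v: "aval (weight_P b) s = \<alpha> i b" "aval (weight_Q b) s = \<beta> i b" for b
    using assms by (auto simp: weight_P_def weight_Q_def \<alpha> \<beta> params_def)
  have i: "int i \<le> X" using assms(3) n_le_X by simp
  have w: "\<bar>\<alpha> i b\<bar> \<le> X" "\<bar>\<beta> i b\<bar> \<le> X" for b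
    using weight_le_D[OF assms(3), of b] D_le_M[OF assms(3)] M_le_X M_pos by auto
  show "bounded X (weight_P b) s" "bounded X (weight_Q b) s"
    using assms i w[of b] M_le_X M_pos den_bounds[OF assms(3)] pn[of i] qn[of i]
    by (auto simp: weight_P_def weight_Q_def \<alpha> \<beta> params_def)
  show "asize (weight_P b) \<le> 9" "asize (weight_Q b) \<le> 9" by (auto simp: weight_P_def weight_Q_def)
qed

lemma wp_branch_com:
  assumes s: "params s" "ivar s ''i'' = int i" "ivar s ''o'' = int i * width" "ivar s ''j'' = j"
    and i: "i < n" and rows: "rows i S (iarr s ''P'') (iarr s ''Q'')"
    and j: "j \<in> {-B..B}" and S: "(j, b) \<notin> S" "S \<subseteq> atom_indices"
    and Q: "\<And>a' s'. a' \<le> a + 20 * L + 150 \<Longrightarrow> params s' \<Longrightarrow> ivar s' ''i'' = int i \<Longrightarrow>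
      ivar s' ''o'' = int i * width \<Longrightarrow> ivar s' ''j'' = j \<Longrightarrow>
      rows i (insert (j, b) S) (iarr s' ''P'') (iarr s' ''Q'') \<Longrightarrow> Q a' s'"
  shows "wp X (branch_com b) Q a s"
proof -
  define x where "x = atomP i (j, b)"
  define y where "y = atomQ i (j, b)"
  have idx: "(j, b) \<in> atom_indices" using j by (simp add: atom_indices_def)
  have row: "iarr s ''P'' (int i * width + j) = massP i j" "iarr s ''Q'' (int i * width + j) = massQ i j"
    using rows j unfolding rows_def by blast+
  note at = atoms(1,2,6,7)[OF layer_ok[OF less_imp_le[OF i]] i, of "(j, b)"]
  have xy: "0 \<le> x" "x \<le> M" "0 \<le> y" "y \<le> M"
    using at(1,2) at(3,4)[OF idx] total_le[of "Suc i"] i by (auto simp: x_def y_def)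
  have x: "massP i j * \<alpha> i b = x" and y: "massQ i j * \<beta> i b = y"
    by (simp_all add: x_def y_def atomP_def atomQ_def)
  note ad = address_le[OF less_imp_le[OF i]]
  have offset: "\<bar>off\<bar> \<le> X \<and> \<bar>off + j\<bar> \<le> X" if "0 \<le> off" "off + 2 * width \<le> X" for off
    using that j B_nonneg by auto
  have bX: "\<bar>int i * width\<bar> \<le> X" "\<bar>int i * width + j\<bar> \<le> X" "\<bar>j\<bar> \<le> X" "\<bar>width\<bar> \<le> X"
    "\<bar>massP i j\<bar> \<le> X" "\<bar>massQ i j\<bar> \<le> X" "\<bar>x\<bar> \<le> X" "\<bar>y\<bar> \<le> X"
    using offset[OF ad] j B_nonneg B_le mass_bounds[OF less_imp_le[OF i] j] M_le_X M_pos xy by auto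
  let ?r = "int i * width + width"
  have bk: "bucket x y \<in> {-B..B}" unfolding x_def y_def
    using bucket_in[OF layer_ok[OF less_imp_le[OF i]] i idx] .
  have rk: "iarr s ''P'' (?r + bucket x y) = partP i S (bucket x y)"
    "iarr s ''Q'' (?r + bucket x y) = partQ i S (bucket x y)"
    using rows bk unfolding rows_def by blast+
  note pb = part_bounds[OF i S(2) idx S(1), of "bucket x y", folded x_def y_def]
  have add: "wp X add_com Q a1 (set_var ''v'' y (set_var ''u'' x s))" if a1: "a1 \<le> a + 40" for a1
  proof (rule wp_add_com[where x = x and y = y and r = ?r])
    fix a' and s' :: state
    assume *: "a' \<le> a1 + 20 * L + 100"
      "\<forall>z. z \<notin> {''z'', ''k''} \<longrightarrow> ivar s' z = ivar (set_var ''v'' y (set_var ''u'' x s)) z"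
      "iarr s' = (iarr (set_var ''v'' y (set_var ''u'' x s)))
       (''P'' := (iarr (set_var ''v'' y (set_var ''u'' x s)) ''P'')
         (?r + bucket x y := iarr (set_var ''v'' y (set_var ''u'' x s)) ''P'' (?r + bucket x y) + x),
        ''Q'' := (iarr (set_var ''v'' y (set_var ''u'' x s)) ''Q'')
         (?r + bucket x y := iarr (set_var ''v'' y (set_var ''u'' x s)) ''Q'' (?r + bucket x y) + y))"
    have "rows i (insert (j, b) S) (iarr s' ''P'') (iarr s' ''Q'')"
      using rows_insert[OF rows i idx S] by (simp add: *(3) x_def y_def)
    then show "Q a' s'" using * s a1 by (intro Q) (auto simp: params_def)
  qed (use s xy ad j B_nonneg B_le rk pb in \<open>auto simp: params_def\<close>)
  \<comment> \<open>The weight for Q is evaluated after the assignment to \<open>u\<close>, so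
    \<open>weight_aval\<close> is needed for that state too.\<close>
  have u: "params (set_var ''u'' x s)" "ivar (set_var ''u'' x s) ''i'' = int i" using s by (auto simp: params_def)
  note w = weight_aval[OF s(1,2) i, of b] weight_aval[OF u i, of b]
  show ?thesis unfolding branch_com_def
    by (intro wp_Seq wp_Assign) (use add w s row x y bX in auto)
qed

lemma wp_layer_com:
  assumes s: "params s" "ivar s ''i'' = int i" "ivar s ''o'' = int i * width"
    and i: "i < n" and rows: "rows i {} (iarr s ''P'') (iarr s ''Q'')"
    and Q: "\<And>a' s'. a' \<le> a + nat width * (40 * L + 330) + 50 \<Longrightarrow> params s' \<Longrightarrow> ivar s' ''i'' = int (Suc i) \<Longrightarrow>
      ivar s' ''o'' = int (Suc i) * width \<Longrightarrow> rows (Suc i) {} (iarr s' ''P'') (iarr s' ''Q'') \<Longrightarrow> Q a' s'"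
  shows "wp X layer_com Q a s"
proof -
  define S where "S = (\<lambda>m. {-B..<-B + int m} \<times> (UNIV :: bool set))"
  \<comment> \<open>Each of the two branches takes at most \<open>20 * L + 150\<close> units. The
    remaining 30 cover the guard and the increment of \<open>j\<close>.\<close>
  define I where "I = (\<lambda>m a' s'. a' \<le> a + 10 + m * (40 * L + 330) \<and> params s' \<and> ivar s' ''i'' = int i \<and>
    ivar s' ''o'' = int i * width \<and> ivar s' ''j'' = -B + int m \<and> rows i (S m) (iarr s' ''P'') (iarr s' ''Q''))"
  note ad = address_le[OF less_imp_le[OF i]]
  have BX: "\<bar>B\<bar> \<le> X" "\<bar>B + 1\<bar> \<le> X" using B_nonneg B_le by auto
  have loop: "wp X (While (Less (Var ''j'') (Plus (Var ''B'') (Const 1)))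
      (branch_com False ;; branch_com True ;; incr ''j''))
      (wp X (Assign ''o'' (Plus (Var ''o'') (Var ''W'')) ;; incr ''i'') Q) a0 (set_var ''j'' (-B) s)"
    if a0: "a0 \<le> a + 10" for a0
  proof (rule wp_loop[where I = I and K = "nat width"])
    show "I 0 a0 (set_var ''j'' (-B) s)"
      using s rows a0 by (auto simp: I_def S_def params_def)
  next
    fix m a1 s1 assume m: "m < nat width" and "I m a1 s1"
    then have I: "a1 \<le> a + 10 + m * (40 * L + 330)" "params s1" "ivar s1 ''i'' = int i"
      "ivar s1 ''o'' = int i * width" "ivar s1 ''j'' = -B + int m"
      "rows i (S m) (iarr s1 ''P'') (iarr s1 ''Q'')" by (auto simp: I_def)
    let ?j = "-B + int m"
    have j: "?j \<in> {-B..B}" using m by auto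
    have sub: "S m \<subseteq> atom_indices" "insert (?j, False) (S m) \<subseteq> atom_indices"
      using j by (auto simp: S_def atom_indices_def)
    have new: "(?j, False) \<notin> S m" "(?j, True) \<notin> insert (?j, False) (S m)" by (auto simp: S_def)
    have S_Suc: "insert (?j, True) (insert (?j, False) (S m)) = S (Suc m)"
    proof -
      have "{-B..<-B + int (Suc m)} = insert ?j {-B..<-B + int m}" by auto
      then show ?thesis by (auto simp: S_def UNIV_bool)
    qed
    have "wp X (branch_com False ;; branch_com True ;; incr ''j'') (I (Suc m)) a2 s1"
      if a2: "a2 \<le> a1 + 10" for a2
    proof (rule wp_Seq, rule wp_branch_com[OF I(2-5) i I(6) j new(1) sub(1)])
      fix a3 s3 assume 3: "a3 \<le> a2 + 20 * L + 150" "params s3" "ivar s3 ''i'' = int i"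
        "ivar s3 ''o'' = int i * width" "ivar s3 ''j'' = ?j"
        "rows i (insert (?j, False) (S m)) (iarr s3 ''P'') (iarr s3 ''Q'')"
      show "wp X (branch_com True ;; incr ''j'') (I (Suc m)) a3 s3"
      proof (rule wp_Seq, rule wp_branch_com[OF 3(2-5) i 3(6) j new(2) sub(2)])
        fix a4 s4 assume 4: "a4 \<le> a3 + 20 * L + 150" "params s4" "ivar s4 ''i'' = int i"
          "ivar s4 ''o'' = int i * width" "ivar s4 ''j'' = ?j"
          "rows i (insert (?j, True) (insert (?j, False) (S m))) (iarr s4 ''P'') (iarr s4 ''Q'')"
        then show "wp X (incr ''j'') (I (Suc m)) a4 s4"
          unfolding incr_def S_Suc using j B_nonneg B_le X(1) I(1) 3(1) a2
          by (intro wp_Assign) (auto simp: I_def params_def)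
      qed
    qed
    then show "bbounded X (Less (Var ''j'') (Plus (Var ''B'') (Const 1))) s1 \<and>
        bval (Less (Var ''j'') (Plus (Var ''B'') (Const 1))) s1 \<and>
        wp X (branch_com False ;; branch_com True ;; incr ''j'') (I (Suc m))
          (a1 + (1 + bsize (Less (Var ''j'') (Plus (Var ''B'') (Const 1))))) s1"
      using I(2,5) j BX X(1) by (auto simp: params_def)
  next
    fix a1 s1 assume "I (nat width) a1 s1"
    then have I: "a1 \<le> a + 10 + nat width * (40 * L + 330)" "params s1" "ivar s1 ''i'' = int i"
      "ivar s1 ''o'' = int i * width" "ivar s1 ''j'' = B + 1"
      "rows i (S (nat width)) (iarr s1 ''P'') (iarr s1 ''Q'')" using B_nonneg by (auto simp: I_def)
    have "S (nat width) = atom_indices"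
      using B_nonneg by (auto simp: S_def atom_indices_def)
    then have next_rows: "rows (Suc i) {} (iarr s1 ''P'') (iarr s1 ''Q'')" using rows_next I(6) by simp
    have off: "\<bar>off\<bar> \<le> X \<and> \<bar>off + width\<bar> \<le> X \<and> \<bar>width\<bar> \<le> X" if "0 \<le> off" "off + 2 * width \<le> X" for off
      using that B_nonneg by auto
    have o: "int i * width + width = int (Suc i) * width" by (simp add: algebra_simps)
    have "wp X (Assign ''o'' (Plus (Var ''o'') (Var ''W'')) ;; incr ''i'') Q a2 s1" if "a2 \<le> a1 + 10" for a2
      unfolding incr_def
      by (intro wp_Seq wp_Assign Q)
        (use that I next_rows off[OF ad] i n_le_X X(1) o in \<open>auto simp: params_def\<close>)
    then show "bbounded X (Less (Var ''j'') (Plus (Var ''B'') (Const 1))) s1 \<and>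
        \<not> bval (Less (Var ''j'') (Plus (Var ''B'') (Const 1))) s1 \<and>
        wp X (Assign ''o'' (Plus (Var ''o'') (Var ''W'')) ;; incr ''i'') Q
          (a1 + (1 + bsize (Less (Var ''j'') (Plus (Var ''B'') (Const 1))))) s1"
      using I(2,5) BX X(1) by (auto simp: params_def)
  qed
  show ?thesis unfolding layer_com_def
    by (rule wp_Seq, rule wp_Assign, use BX X(1) s(1) in \<open>simp add: params_def\<close>,
        rule wp_Seq) (use loop s(1) in \<open>simp add: params_def\<close>)
qed

lemma wp_sum_com:
  assumes s: "params s" "ivar s ''o'' = int n * width" and rows: "rows n {} (iarr s ''P'') (iarr s ''Q'')"
    and Q: "\<And>a' s'. a' \<le> a + nat width * 50 + 50 \<Longrightarrow> params s' \<Longrightarrow>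
      ivar s' ''out_num'' = (\<Sum>j\<in>{-B..B}. max 0 (massP n j - massQ n j)) \<Longrightarrow> Q a' s'"
  shows "wp X sum_com Q a s"
proof -
  define f where "f = (\<lambda>j. max 0 (massP n j - massQ n j))"
  define I where "I = (\<lambda>m a' s'. a' \<le> a + 10 + m * 50 \<and> params s' \<and> ivar s' ''o'' = int n * width \<and>
    ivar s' ''j'' = -B + int m \<and> ivar s' ''out_num'' = sum f {-B..<-B + int m} \<and>
    rows n {} (iarr s' ''P'') (iarr s' ''Q''))"
  note ad = address_le[OF order_refl]
  have BX: "\<bar>B\<bar> \<le> X" "\<bar>B + 1\<bar> \<le> X" using B_nonneg B_le by auto
  have mb: "0 \<le> massP n j" "massP n j \<le> M" "0 \<le> massQ n j" "massQ n j \<le> M" if "j \<in> {-B..B}" for j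
    using mass_bounds[OF order_refl that] .
  \<comment> \<open>A positive part is at most the P-mass, and these masses sum to \<open>M\<close>.
    Hence \<open>X\<close> bounds the accumulator throughout the loop.\<close>
  have fM: "0 \<le> sum f {-B..<t} \<and> sum f {-B..<t} \<le> M" if "t \<le> B + 1" for t
  proof
    show "0 \<le> sum f {-B..<t}" by (intro sum_nonneg) (simp add: f_def)
    have "sum f {-B..<t} \<le> sum f {-B..B}" using that by (intro sum_mono2) (auto simp: f_def)
    also have "\<dots> \<le> sum (massP n) {-B..B}" by (intro sum_mono) (use mb in \<open>auto simp: f_def\<close>)
    also have "\<dots> = M" using layer_ok[OF order_refl] by (simp add: layer_ok_def total_def M_def)
    finally show "sum f {-B..<t} \<le> M" .
  qed
  let ?body = "Cond (Less (Read ''Q'' (Plus (Var ''o'') (Var ''j''))) (Read ''P'' (Plus (Var ''o'') (Var ''j''))))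
        (Assign ''out_num'' (Plus (Var ''out_num'')
          (Minus (Read ''P'' (Plus (Var ''o'') (Var ''j''))) (Read ''Q'' (Plus (Var ''o'') (Var ''j''))))))
        Skip ;; incr ''j''"
  have loop: "wp X (While (Less (Var ''j'') (Plus (Var ''B'') (Const 1))) ?body) Q a0
      (set_var ''j'' (-B) (set_var ''out_num'' 0 s))" if a0: "a0 \<le> a + 10" for a0
  proof (rule wp_loop[where I = I and K = "nat width"])
    show "I 0 a0 (set_var ''j'' (-B) (set_var ''out_num'' 0 s))"
      using s rows a0 by (auto simp: I_def params_def)
  next
    fix m a1 s1 assume m: "m < nat width" and "I m a1 s1"
    then have I: "a1 \<le> a + 10 + m * 50" "params s1" "ivar s1 ''o'' = int n * width" "ivar s1 ''j'' = -B + int m"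
      "ivar s1 ''out_num'' = sum f {-B..<-B + int m}" "rows n {} (iarr s1 ''P'') (iarr s1 ''Q'')"
      by (auto simp: I_def)
    define j where "j = -B + int m"
    have j: "j \<in> {-B..B}" using m by (auto simp: j_def)
    have row: "iarr s1 ''P'' (int n * width + j) = massP n j" "iarr s1 ''Q'' (int n * width + j) = massQ n j"
      using I(6) j unfolding rows_def by blast+
    have off: "\<bar>off\<bar> \<le> X \<and> \<bar>off + j\<bar> \<le> X \<and> \<bar>j\<bar> \<le> X" if "0 \<le> off" "off + 2 * width \<le> X" for off
      using that j B_nonneg by auto
    have "{-B..<j + 1} = insert j {-B..<j}" using j by auto
    then have f_Suc: "sum f {-B..<j + 1} = sum f {-B..<j} + f j" by simp
    have "1 + int m - B = j + 1" "int m - B = j" by (simp_all add: j_def)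
    then have f_Suc': "sum f {-B..<1 + int m - B} = sum f {-B..<int m - B} + f (int m - B)"
      by (simp only: f_Suc)
    have fb: "0 \<le> sum f {-B..<j}" "sum f {-B..<j} + f j \<le> M" "sum f {-B..<j} \<le> M"
      using fM[of j] fM[of "j + 1"] j f_Suc by auto
    have "wp X (incr ''j'') (I (Suc m)) a2 (set_var ''out_num'' (sum f {-B..<j} + f j) s1)" if "a2 \<le> a1 + 40" for a2
      unfolding incr_def using that I j BX X(1) f_Suc'
      by (intro wp_Assign) (auto simp: I_def params_def j_def add.assoc)
    moreover have "wp X (incr ''j'') (I (Suc m)) a2 s1" if "a2 \<le> a1 + 40" "f j = 0" for a2
      unfolding incr_def using that I j BX X(1) f_Suc'
      by (intro wp_Assign) (auto simp: I_def params_def j_def add.assoc)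
    ultimately have "wp X ?body (I (Suc m)) a2 s1" if "a2 \<le> a1 + 10" for a2
      using that I(2-5)[folded j_def] row off[OF ad] mb[OF j] M_le_X M_pos fb
      by (intro wp_Seq wp_Cond wp_Assign wp_Skip) (auto simp: f_def)
    then show "bbounded X (Less (Var ''j'') (Plus (Var ''B'') (Const 1))) s1 \<and>
        bval (Less (Var ''j'') (Plus (Var ''B'') (Const 1))) s1 \<and>
        wp X ?body (I (Suc m)) (a1 + (1 + bsize (Less (Var ''j'') (Plus (Var ''B'') (Const 1))))) s1"
      using I(2,4) j BX X(1) by (auto simp: params_def j_def)
  next
    fix a1 s1 assume "I (nat width) a1 s1"
    then have I: "a1 \<le> a + 10 + nat width * 50" "params s1" "ivar s1 ''j'' = B + 1"
      "ivar s1 ''out_num'' = sum f {-B..<B + 1}" using B_nonneg by (auto simp: I_def)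
    have "{-B..<B + 1} = {-B..B}" by auto
    with I(1,2,4) have "Q a2 s1" if "a2 \<le> a1 + 10" for a2 using that by (intro Q) (auto simp: f_def)
    with I show "bbounded X (Less (Var ''j'') (Plus (Var ''B'') (Const 1))) s1 \<and>
        \<not> bval (Less (Var ''j'') (Plus (Var ''B'') (Const 1))) s1 \<and>
        Q (a1 + (1 + bsize (Less (Var ''j'') (Plus (Var ''B'') (Const 1))))) s1"
      using BX X(1) by (auto simp: params_def)
  qed
  show ?thesis unfolding sum_com_def
    by (rule wp_Seq, rule wp_Assign, use X(1) in simp,
        rule wp_Seq, rule wp_Assign, use BX X(1) s(1) in \<open>simp add: params_def\<close>)
      (use loop s(1) in \<open>simp add: params_def\<close>)
qed

lemma wp_init_com:
  assumes s: "ivar s ''n'' = int n" "ivar s ''eps_num'' = e" "ivar s ''eps_den'' = d" "ivar s ''o'' = 0"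
      "iarr s ''p_num'' = pn" "iarr s ''p_den'' = pd" "iarr s ''q_num'' = qn" "iarr s ''q_den'' = qd"
      "iarr s ''P'' = (\<lambda>_. 0)" "iarr s ''Q'' = (\<lambda>_. 0)"
    and e: "0 < e" "e \<le> X" and d: "0 < d" "2 * int n * d \<le> X" "d \<le> X" and N: "N = 2 * int n * d div e + 1"
    and Q: "\<And>a' s'. a' \<le> a + n * 20 + 20 * L + 100 \<Longrightarrow> params s' \<Longrightarrow> ivar s' ''i'' = 0 \<Longrightarrow>
      ivar s' ''o'' = 0 \<Longrightarrow> rows 0 {} (iarr s' ''P'') (iarr s' ''Q'') \<Longrightarrow> Q a' s'"
  shows "wp X init_com Q a s"
proof -
  define same where "same = (\<lambda>s' :: state. iarr s' = iarr s \<and> ivar s' ''n'' = int n \<and> ivar s' ''eps_num'' = e \<and>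
    ivar s' ''eps_den'' = d \<and> ivar s' ''o'' = 0)"
  define I where "I = (\<lambda>m a' s'. a' \<le> a + 10 + m * 20 \<and> same s' \<and> ivar s' ''i'' = int m \<and> ivar s' ''M'' = total m)"
  let ?rest = "Assign ''N'' (Plus (Quot (Times (Times (Const 2) (Var ''n'')) (Var ''eps_den'')) (Var ''eps_num'')) (Const 1)) ;;
    Assign ''z'' (Times (Times (Var ''M'') (Var ''M'')) (Var ''N'')) ;;
    scale_com ;;
    Assign ''B'' (Var ''k'') ;;
    Assign ''W'' (Plus (Times (Const 2) (Var ''B'')) (Const 1)) ;;
    Store ''P'' (Const 0) (Const 1) ;;
    Store ''Q'' (Const 0) (Const 1) ;;
    Assign ''i'' (Const 0)"
  have MM: "M * M * 1 \<le> M * M * N" "0 \<le> M * M" using M_pos N_pos by (intro mult_left_mono) auto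
  have MM0: "0 \<le> M * M * N" using M_pos N_pos by simp
  have absMM: "\<bar>M * M\<bar> \<le> X" "\<bar>M * M * N\<bar> \<le> X" "0 \<le> M * M * N"
    unfolding abs_of_nonneg[OF MM(2)] abs_of_nonneg[OF MM0] using MM MM0 X(2) by linarith+
  have nd: "0 \<le> 2 * int n * d" "0 \<le> 2 * int n * d div e" "\<bar>2 * int n\<bar> \<le> X"
  proof -
    show "0 \<le> 2 * int n * d" using d by simp
    then show "0 \<le> 2 * int n * d div e" using e by (simp only: pos_imp_zdiv_nonneg_iff)
    have "2 * int n * 1 \<le> 2 * int n * d" using d by (intro mult_left_mono) auto
    with d(2) show "\<bar>2 * int n\<bar> \<le> X" by simp
  qed
  have dX: "\<bar>2 * int n * d\<bar> \<le> X" "\<bar>d\<bar> \<le> X" "\<bar>e\<bar> \<le> X" using nd(1) d e by auto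
  have NX: "\<bar>2 * int n * d div e + 1\<bar> \<le> X" "\<bar>2 * int n * d div e\<bar> \<le> X"
    using N N_pos M_le_X(2) nd(2) by auto
  have B: "scale_index N (M * M * N) = B" by (simp add: B_def)
  have rest: "wp X ?rest Q a1 s1"
    if a1: "a1 \<le> a + n * 20 + 20" and s1: "same s1" "ivar s1 ''M'' = M" for a1 and s1 :: state
  proof -
    let ?s2 = "set_var ''z'' (M * M * N) (set_var ''N'' N s1)"
    let ?last = "Assign ''B'' (Var ''k'') ;;
      Assign ''W'' (Plus (Times (Const 2) (Var ''B'')) (Const 1)) ;;
      Store ''P'' (Const 0) (Const 1) ;;
      Store ''Q'' (Const 0) (Const 1) ;;
      Assign ''i'' (Const 0)"
    have scale: "wp X (scale_com ;; ?last) Q a2 ?s2" if a2: "a2 \<le> a1 + 30" for a2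
    proof (rule wp_Seq, rule wp_scale_com[where N = N and L = L])
      fix a' and s' :: state assume *: "a' \<le> a2 + 20 * L + 20" "ivar s' ''k'' = scale_index N (ivar ?s2 ''z'')"
        "\<forall>x. x \<notin> {''z'', ''k''} \<longrightarrow> ivar s' x = ivar ?s2 x" "iarr s' = iarr ?s2"
      have k: "ivar s' ''k'' = B" using * B by simp
      show "wp X ?last Q a' s'"
        by (intro wp_Seq wp_Assign wp_Store Q)
          (use * k s s1 a1 a2 B_nonneg B_le X(1) rows_0 in \<open>auto simp: params_def same_def\<close>)
    qed (use N_pos M_le_X absMM B B_nonneg B_le L X(2) in auto)
    have z: "wp X (Assign ''z'' (Times (Times (Var ''M'') (Var ''M'')) (Var ''N'')) ;; scale_com ;; ?last) Q a2
      (set_var ''N'' N s1)" if "a2 \<le> a1 + 20" for a2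
      by (rule wp_Seq, rule wp_Assign)
        (use that scale s1 absMM M_pos M_le_X N_pos in \<open>auto simp: same_def\<close>)
    show ?thesis
      by (rule wp_Seq, rule wp_Assign)
        (use z s1 nd dX NX X(1) n_le_X in \<open>auto simp: same_def N\<close>)
  qed
  have loop: "wp X (While (Less (Var ''i'') (Var ''n''))
      (Assign ''M'' (Times (Var ''M'') (Times (Read ''p_den'' (Var ''i'')) (Read ''q_den'' (Var ''i'')))) ;;
      incr ''i'')) (wp X ?rest Q) a0 (set_var ''i'' 0 (set_var ''M'' 1 s))" if a0: "a0 \<le> a + 10" for a0
  proof (rule wp_loop[where I = I and K = n])
    show "I 0 a0 (set_var ''i'' 0 (set_var ''M'' 1 s))"
      using s a0 by (auto simp: I_def same_def total_def)
  next
    fix m a1 s1 assume m: "m < n" and I: "I m a1 s1"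
    note db = den_bounds[OF m]
    have t: "0 < total m" "total m \<le> M" "total (Suc m) \<le> M" "0 < total (Suc m)" "0 < D m" "D m \<le> M"
      using total_pos[of m] total_le[of m] total_le[of "Suc m"] total_pos[of "Suc m"] m D_pos D_le_M by auto
    have tS: "total m * (pd (int m) * qd (int m)) = total (Suc m)" by (simp add: total_Suc D_eq)
    have "wp X (Assign ''M'' (Times (Var ''M'') (Times (Read ''p_den'' (Var ''i'')) (Read ''q_den'' (Var ''i'')))) ;;
        incr ''i'') (I (Suc m)) (a1 + 5) s1"
      unfolding incr_def
      by (intro wp_Seq wp_Assign)
        (use I m s db t tS M_le_X n_le_X D_eq[of m] X(1) in \<open>auto simp: I_def same_def\<close>)
    then show "bbounded X (Less (Var ''i'') (Var ''n'')) s1 \<and> bval (Less (Var ''i'') (Var ''n'')) s1 \<and>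
        wp X (Assign ''M'' (Times (Var ''M'') (Times (Read ''p_den'' (Var ''i'')) (Read ''q_den'' (Var ''i'')))) ;;
        incr ''i'') (I (Suc m)) (a1 + (1 + bsize (Less (Var ''i'') (Var ''n'')))) s1"
      using I m n_le_X by (simp add: I_def same_def eval_nat_numeral)
  next
    fix a1 s1 assume I: "I n a1 s1"
    show "bbounded X (Less (Var ''i'') (Var ''n'')) s1 \<and> \<not> bval (Less (Var ''i'') (Var ''n'')) s1 \<and>
        wp X ?rest Q (a1 + (1 + bsize (Less (Var ''i'') (Var ''n'')))) s1"
      using I n_le_X by (auto simp: I_def same_def total_def M_def intro!: rest)
  qed
  show ?thesis unfolding init_com_def
    by (rule wp_Seq, rule wp_Assign, use X(1) in simp,
        rule wp_Seq, rule wp_Assign, use X(1) in simp, rule wp_Seq) (use loop in simp)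
qed

lemma wp_tv_com:
  assumes s: "ivar s ''n'' = int n" "ivar s ''eps_num'' = e" "ivar s ''eps_den'' = d" "ivar s ''o'' = 0"
      "iarr s ''p_num'' = pn" "iarr s ''p_den'' = pd" "iarr s ''q_num'' = qn" "iarr s ''q_den'' = qd"
      "iarr s ''P'' = (\<lambda>_. 0)" "iarr s ''Q'' = (\<lambda>_. 0)"
    and e: "0 < e" "e \<le> X" and d: "0 < d" "2 * int n * d \<le> X" "d \<le> X" and N: "N = 2 * int n * d div e + 1"
  shows "wp X tv_com (\<lambda>a' s'. a' \<le> (n + 4) * (nat width * (40 * L + 400) + 200) \<and>
    ivar s' ''out_num'' = (\<Sum>j\<in>{-B..B}. max 0 (massP n j - massQ n j)) \<and> ivar s' ''out_den'' = M) 0 s"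
    (is "wp X tv_com ?Q 0 s")
proof -
  \<comment> \<open>The cost of a layer: the additive constant consists of 50 from
    \<open>wp_layer_com\<close> and 10 for the guard of the outer loop.\<close>
  define c where "c = nat width * (40 * L + 330) + 60"
  define I where "I = (\<lambda>m a' s'. a' \<le> n * 20 + 20 * L + 100 + m * c \<and> params s' \<and> ivar s' ''i'' = int m \<and>
    ivar s' ''o'' = int m * width \<and> rows m {} (iarr s' ''P'') (iarr s' ''Q''))"
  have width: "1 \<le> nat width" using B_nonneg by simp
  have final: "n * 20 + 20 * L + 100 + n * c + nat width * 50 + 100
      \<le> (n + 4) * (nat width * (40 * L + 400) + 200)"
  proof -
    \<comment> \<open>With the width written as a successor, both sides become polynomials with
      nonnegative coefficients that can be compared term by term.\<close>
    obtain w where w: "nat width = Suc w" using width by (cases "nat width") auto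
    show ?thesis unfolding c_def w by (simp add: algebra_simps)
  qed
  have sum: "wp X (sum_com ;; Assign ''out_den'' (Var ''M'')) ?Q a1 s1"
    if I: "I n a2 s1" and a1: "a1 \<le> a2 + 10" for a1 a2 s1
  proof (rule wp_Seq, rule wp_sum_com)
    fix a' s' assume "a' \<le> a1 + nat width * 50 + 50" "params s'"
      "ivar s' ''out_num'' = (\<Sum>j\<in>{-B..B}. max 0 (massP n j - massQ n j))"
    moreover have "a1 + nat width * 50 + 60 \<le> (n + 4) * (nat width * (40 * L + 400) + 200)"
      using final I a1 by (simp add: I_def)
    ultimately show "wp X (Assign ''out_den'' (Var ''M'')) ?Q a' s'"
      using M_le_X M_pos by (intro wp_Assign) (auto simp: params_def)
  qed (use I in \<open>auto simp: I_def\<close>)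
  show ?thesis unfolding tv_com_def
  proof (rule wp_Seq, rule wp_init_com[OF s e d N])
    fix a0 s0 assume init: "a0 \<le> 0 + n * 20 + 20 * L + 100" "params s0" "ivar s0 ''i'' = 0" "ivar s0 ''o'' = 0"
      "rows 0 {} (iarr s0 ''P'') (iarr s0 ''Q'')"
    show "wp X (While (Less (Var ''i'') (Var ''n'')) layer_com ;; sum_com ;; Assign ''out_den'' (Var ''M'')) ?Q a0 s0"
    proof (rule wp_Seq, rule wp_loop[where I = I and K = n])
      show "I 0 a0 s0" using init by (simp add: I_def)
    next
      fix m a s assume m: "m < n" and I: "I m a s"
      have "wp X layer_com (I (Suc m)) (a + (1 + bsize (Less (Var ''i'') (Var ''n'')))) s"
        by (rule wp_layer_com[where i = m]) (use I m in \<open>auto simp: I_def c_def\<close>)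
      then show "bbounded X (Less (Var ''i'') (Var ''n'')) s \<and> bval (Less (Var ''i'') (Var ''n'')) s \<and>
          wp X layer_com (I (Suc m)) (a + (1 + bsize (Less (Var ''i'') (Var ''n'')))) s"
        using I m n_le_X by (simp add: I_def params_def)
    next
      fix a s assume I: "I n a s"
      then show "bbounded X (Less (Var ''i'') (Var ''n'')) s \<and> \<not> bval (Less (Var ''i'') (Var ''n'')) s \<and>
          wp X (sum_com ;; Assign ''out_den'' (Var ''M'')) ?Q (a + (1 + bsize (Less (Var ''i'') (Var ''n'')))) s"
        using n_le_X sum[OF I] by (simp add: I_def params_def)
    qed
  qed
qed

end

section \<open>Product distributions\<close>

lemma sum_PiE_dflt_insert:
  fixes h :: "('a \<Rightarrow> bool) \<Rightarrow> 'b::comm_monoid_add"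
  assumes "i \<notin> S"
  shows "(\<Sum>x\<in>PiE_dflt (insert i S) False (\<lambda>_. UNIV). h x)
    = (\<Sum>b\<in>UNIV. \<Sum>x\<in>PiE_dflt S False (\<lambda>_. UNIV). h (x(i := b)))"
  unfolding sum.cartesian_product
  by (rule sum.reindex_bij_witness[of _ "\<lambda>(b, x). x(i := b)" "\<lambda>x. (x i, x(i := False))"])
    (use assms in \<open>auto simp: PiE_dflt_def fun_upd_idem\<close>)

context weights begin

text \<open>The unrolled recursion: each assignment of bits to the remaining coordinates multiplies
  the two masses by its scaled probabilities.\<close>

lemma tail_eq_sum:
  "tail m i u v = (\<Sum>x\<in>PiE_dflt {i..<i + m} False (\<lambda>_. UNIV).
    max 0 (u * (\<Prod>l\<in>{i..<i + m}. of_int (\<alpha> l (x l))) - v * (\<Prod>l\<in>{i..<i + m}. of_int (\<beta> l (x l)))))"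
proof (induction m arbitrary: i u v)
  case 0
  have "PiE_dflt {} False (\<lambda>_. UNIV) = {\<lambda>_ :: nat. False}" by (auto simp: PiE_dflt_def)
  then show ?case by simp
next
  case (Suc m)
  define S where "S = {Suc i..<Suc i + m}"
  have ins: "{i..<i + Suc m} = insert i S" and S: "i \<notin> S" "finite S" by (auto simp: S_def)
  have pr: "(\<Prod>l\<in>insert i S. of_int (\<gamma> l ((x(i := b)) l))) = (of_int (\<gamma> i b) * (\<Prod>l\<in>S. of_int (\<gamma> l (x l))) :: real)"
    for \<gamma> :: "nat \<Rightarrow> bool \<Rightarrow> int" and x b
  proof -
    have "(\<Prod>l\<in>S. real_of_int (\<gamma> l ((x(i := b)) l))) = (\<Prod>l\<in>S. of_int (\<gamma> l (x l)))"
      using S by (intro prod.cong) auto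
    then show ?thesis using S by simp
  qed
  show ?case unfolding ins sum_PiE_dflt_insert[OF S(1)] pr tail.simps Suc.IH S_def[symmetric]
    by (simp only: mult.assoc)
qed

text \<open>The positive part of \<open>t\<close> is \<open>(|t| + t) / 2\<close>. Summed over the
  cube, the linear terms cancel because P and Q both have total probability 1.\<close>

lemma tail_eq_dTV:
  assumes P: "\<And>x. x \<in> cube n \<Longrightarrow> pmf P x = (\<Prod>l<n. of_int (\<alpha> l (x l)) / of_int (D l))" "set_pmf P \<subseteq> cube n"
    and Q: "\<And>x. x \<in> cube n \<Longrightarrow> pmf Q x = (\<Prod>l<n. of_int (\<beta> l (x l)) / of_int (D l))" "set_pmf Q \<subseteq> cube n"
  shows "tail n 0 1 1 = of_int M * dTV (cube n) P Q"
proof -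
  have fin: "finite (cube n)" unfolding cube_def by (intro finite_PiE_dflt) auto
  have M: "of_int M = (\<Prod>l<n. real_of_int (D l))" by (simp add: M_def)
  have D: "(\<Prod>l<n. real_of_int (D l)) \<noteq> 0" using M_pos unfolding M[symmetric] by simp
  have "tail n 0 1 1 = (\<Sum>x\<in>cube n. max 0 ((\<Prod>l<n. of_int (\<alpha> l (x l))) - (\<Prod>l<n. of_int (\<beta> l (x l)))))"
    unfolding tail_eq_sum by (simp add: cube_def lessThan_atLeast0)
  also have "\<dots> = (\<Sum>x\<in>cube n. max 0 (of_int M * (pmf P x - pmf Q x)))"
  proof (rule sum.cong)
    fix x assume x: "x \<in> cube n"
    show "max 0 ((\<Prod>l<n. of_int (\<alpha> l (x l))) - (\<Prod>l<n. of_int (\<beta> l (x l)))) =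
      max 0 (of_int M * (pmf P x - pmf Q x))"
      unfolding P(1)[OF x] Q(1)[OF x] prod_dividef M diff_divide_distrib[symmetric] using D by simp
  qed simp
  also have "\<dots> = (\<Sum>x\<in>cube n. of_int M * ((\<bar>pmf P x - pmf Q x\<bar> + (pmf P x - pmf Q x)) / 2))"
  proof (rule sum.cong)
    fix x
    show "max 0 (of_int M * (pmf P x - pmf Q x)) =
        of_int M * ((\<bar>pmf P x - pmf Q x\<bar> + (pmf P x - pmf Q x)) / 2)"
      using M_pos by (cases "pmf Q x \<le> pmf P x") (auto simp: max_def mult_le_0_iff zero_le_mult_iff)
  qed simp
  also have "\<dots> = of_int M * ((\<Sum>x\<in>cube n. \<bar>pmf P x - pmf Q x\<bar>) + (sum (pmf P) (cube n) - sum (pmf Q) (cube n))) / 2"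
    by (simp add: sum_distrib_left sum_divide_distrib sum.distrib sum_subtractf add_divide_distrib diff_divide_distrib algebra_simps)
  also have "sum (pmf P) (cube n) = 1" by (rule sum_pmf_eq_1[OF fin P(2)])
  also have "sum (pmf Q) (cube n) = 1" by (rule sum_pmf_eq_1[OF fin Q(2)])
  finally show ?thesis by (simp add: dTV_def)
qed

lemma output_close:
  assumes P: "\<And>x. x \<in> cube n \<Longrightarrow> pmf P x = (\<Prod>l<n. of_int (\<alpha> l (x l)) / of_int (D l))" "set_pmf P \<subseteq> cube n"
    and Q: "\<And>x. x \<in> cube n \<Longrightarrow> pmf Q x = (\<Prod>l<n. of_int (\<beta> l (x l)) / of_int (D l))" "set_pmf Q \<subseteq> cube n"
    and \<epsilon>: "2 * real n \<le> \<epsilon> * of_int N"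
    and v: "v = of_int (\<Sum>j\<in>{-B..B}. max 0 (massP n j - massQ n j)) / of_int M"
  shows "(1 - \<epsilon>) * dTV (cube n) P Q \<le> v" "v \<le> dTV (cube n) P Q"
proof -
  define t where "t = dTV (cube n) P Q"
  have t: "tail n 0 1 1 = of_int M * t" unfolding t_def using tail_eq_dTV P Q by blast
  have t0: "0 \<le> t" by (simp add: t_def dTV_def sum_nonneg)
  have M: "0 < real_of_int M" using M_pos by simp
  have v': "of_int M * v = potential n" using M by (simp add: v potential_n)
  have pb: "(1 - 2 * real n / of_int N) * (of_int M * t) \<le> of_int M * v" "of_int M * v \<le> of_int M * t"
    unfolding v' t[symmetric] using potential_bounds[OF order_refl] by auto
  show "v \<le> dTV (cube n) P Q" using pb(2) M by (simp add: t_def)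
  have "2 * real n / of_int N \<le> \<epsilon>" using \<epsilon> N_pos by (simp add: field_simps)
  then have "(1 - \<epsilon>) * (of_int M * t) \<le> (1 - 2 * real n / of_int N) * (of_int M * t)"
    using M t0 by (intro mult_right_mono) auto
  also note pb(1)
  finally have "of_int M * ((1 - \<epsilon>) * t) \<le> of_int M * v" by (simp only: mult_ac)
  then show "(1 - \<epsilon>) * dTV (cube n) P Q \<le> v" using M by (simp add: t_def)
qed

end

lemma den_pos: "0 < den r" by (simp add: den_def quotient_of_denom_pos')

lemma of_rat_num_den: "real_of_rat r = of_int (num r) / of_int (den r)"
proof -
  have "r = of_int (num r) / of_int (den r)"
    unfolding num_def den_def by (rule quotient_of_div) simp
  then have "real_of_rat r = of_rat (of_int (num r) / of_int (den r))" by simp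
  then show ?thesis by (simp add: of_rat_divide)
qed

lemma num_pos_iff: "0 < num r \<longleftrightarrow> 0 < r"
proof -
  have "0 < r \<longleftrightarrow> 0 < real_of_rat r" by simp
  also have "\<dots> \<longleftrightarrow> 0 < num r" unfolding of_rat_num_den using den_pos[of r] by (simp add: zero_less_divide_iff)
  finally show ?thesis ..
qed

lemma num_less_den_iff: "num r < den r \<longleftrightarrow> r < 1"
proof -
  have "r < 1 \<longleftrightarrow> real_of_rat r < 1" by simp
  also have "\<dots> \<longleftrightarrow> num r < den r" unfolding of_rat_num_den using den_pos[of r] by simp
  finally show ?thesis ..
qed

lemma pmf_bern_prod_eq:
  assumes "\<forall>i<length ps. 0 \<le> ps ! i \<and> ps ! i \<le> 1" "x \<in> cube (length ps)"
  shows "pmf (bern_prod ps) x = (\<Prod>i<length ps. if x i then of_rat (ps ! i) else 1 - of_rat (ps ! i))"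
proof -
  have "pmf (bern_prod ps) x = (\<Prod>i<length ps. pmf (bernoulli_pmf (of_rat (ps ! i))) (x i))"
    using assms(2) unfolding bern_prod_def cube_def by (subst pmf_Pi) (auto simp: PiE_dflt_def)
  then show ?thesis using assms(1) by (auto intro!: prod.cong)
qed

lemma set_bern_prod: "set_pmf (bern_prod ps) \<subseteq> cube (length ps)"
  using set_Pi_pmf_subset'[of "{..<length ps}" False "\<lambda>i. bernoulli_pmf (of_rat (ps ! i))"]
  by (auto simp: bern_prod_def cube_def PiE_dflt_def)

lemma space_coins: "space coins = UNIV" by (simp add: coins_def space_stream_space)

lemma prob_space_coins: "prob_space coins"
  unfolding coins_def by (rule prob_space.prob_space_stream_space) (rule measure_pmf.prob_space_axioms)

section \<open>Bit lengths and running time\<close>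

lemma bits_1: "bits 1 = 2"
  by (simp add: bits_def bitlen_alt_def)

lemma bits_less_power: "\<bar>k\<bar> < 2 ^ (bits k - 1)"
  by (simp add: bits_less_iff bits_def)

lemma bits_add: "bits (a + b) \<le> bits a + bits b"
proof -
  define m where "m = max (bits a - 1) (bits b - 1)"
  have "\<bar>a\<bar> < 2 ^ m" "\<bar>b\<bar> < 2 ^ m" unfolding bits_less_iff by (auto simp: m_def)
  then have "\<bar>a + b\<bar> < 2 ^ Suc m" by simp
  then have "bits (a + b) \<le> Suc (Suc m)" by (simp only: bits_less_iff)
  then show ?thesis using bits_pos[of a] bits_pos[of b] by (auto simp: m_def max_def split: if_splits)
qed

text \<open>Subadditivity makes the bit length of \<open>M\<close> linear in the input size;
  bounding it by products of bit lengths would be exponential over \<open>n\<close> factors.\<close>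

lemma bits_mult: "bits (a * b) \<le> bits a + bits b"
proof -
  have "\<bar>a * b\<bar> < 2 ^ (bits a - 1 + (bits b - 1))"
    unfolding abs_mult power_add by (intro mult_strict_mono bits_less_power) auto
  then have "bits (a * b) \<le> Suc (bits a - 1 + (bits b - 1))" by (simp only: bits_less_iff)
  then show ?thesis using bits_pos[of a] bits_pos[of b] by simp
qed

text \<open>A crude bound for numbers such as \<open>n\<close>, \<open>N\<close> and the row width,
  whose value itself is polynomial in the input size and \<open>1 / \<epsilon>\<close>.\<close>

lemma bits_le_nat: "bits k \<le> nat \<bar>k\<bar> + 1"
proof -
  have "\<bar>k\<bar> = int (nat \<bar>k\<bar>)" by simp
  also have "\<dots> < 2 ^ nat \<bar>k\<bar>" by (rule of_nat_less_two_power)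
  finally show ?thesis by (simp only: bits_less_iff Suc_eq_plus1)
qed

lemma bits_prod: "finite S \<Longrightarrow> bits (prod f S) \<le> 2 + (\<Sum>i\<in>S. bits (f i))"
proof (induction S rule: finite_induct)
  case (insert a S)
  then show ?case using bits_mult[of "f a" "prod f S"] by simp
qed (simp add: bits_1)

lemma array_of_nth [simp]: "i < length ks \<Longrightarrow> array_of ks (int i) = ks ! i"
  by (simp add: array_of_def)

lemma array_of_ge [simp]: "length ks \<le> i \<Longrightarrow> array_of ks (int i) = 0"
  by (simp add: array_of_def)

locale tv_input =
  fixes \<epsilon> :: rat and ps qs :: "rat list"
  assumes \<epsilon>: "0 < \<epsilon>" and len: "length ps = length qs"
    and p: "i < length ps \<Longrightarrow> 0 < ps ! i \<and> ps ! i < 1" and q: "i < length ps \<Longrightarrow> 0 < qs ! i \<and> qs ! i < 1"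
begin

definition "n = length ps"
definition "pn = array_of (map num ps)"
definition "pd = array_of (map den ps)"
definition "qn = array_of (map num qs)"
definition "qd = array_of (map den qs)"
definition \<alpha> :: "nat \<Rightarrow> bool \<Rightarrow> int" where
  "\<alpha> i b = (if b then pn (int i) * qd (int i) else (pd (int i) - pn (int i)) * qd (int i))"
definition \<beta> :: "nat \<Rightarrow> bool \<Rightarrow> int" where
  "\<beta> i b = (if b then qn (int i) * pd (int i) else (qd (int i) - qn (int i)) * pd (int i))"
definition "D i = pd (int i) * qd (int i)"
definition "N = 2 * int n * den \<epsilon> div num \<epsilon> + 1"

lemma p_bounds: "i < n \<Longrightarrow> 0 < pn (int i) \<and> pn (int i) < pd (int i)"
  and q_bounds: "i < n \<Longrightarrow> 0 < qn (int i) \<and> qn (int i) < qd (int i)"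
  using p[of i] q[of i] len
  by (simp_all add: n_def pn_def pd_def qn_def qd_def num_pos_iff num_less_den_iff)

lemma out_of_range: "\<not> i < n \<Longrightarrow> pn (int i) = 0 \<and> pd (int i) = 0 \<and> qn (int i) = 0 \<and> qd (int i) = 0"
  using len by (simp add: n_def pn_def pd_def qn_def qd_def)

lemma num_den_\<epsilon>: "0 < num \<epsilon>" "0 < den \<epsilon>"
  using \<epsilon> num_pos_iff den_pos by auto

lemma N_pos': "0 < N"
proof -
  have "0 \<le> 2 * int n * den \<epsilon>" using num_den_\<epsilon> by simp
  then have "0 \<le> 2 * int n * den \<epsilon> div num \<epsilon>" using num_den_\<epsilon> by (simp only: pos_imp_zdiv_nonneg_iff)
  then show ?thesis by (simp add: N_def)
qed

sublocale weights n N \<alpha> \<beta> D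
proof
  fix i b
  show "0 < N" by (rule N_pos')
  show "0 \<le> \<alpha> i b" "0 \<le> \<beta> i b"
    using p_bounds[of i] q_bounds[of i] out_of_range[of i] by (cases "i < n"; simp add: \<alpha>_def \<beta>_def)+
  \<comment> \<open>Both bits have positive probability under Q, since
    \<open>0 < q < 1\<close>.\<close>
  show "i < n \<Longrightarrow> 0 < \<beta> i b" using p_bounds[of i] q_bounds[of i] by (simp add: \<beta>_def)
  show "\<alpha> i False + \<alpha> i True = D i" "\<beta> i False + \<beta> i True = D i"
    by (simp_all add: \<alpha>_def \<beta>_def D_def algebra_simps)
qed

definition L :: nat where "L = bits (M * M * N)"

definition X :: int where
  "X = 4 + num \<epsilon> + 2 * int n * den \<epsilon> + den \<epsilon> + 2 * (M * M * N) + (int n + 2) * (2 * B + 1)"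

lemma X_terms_nonneg: "0 \<le> 2 * int n * den \<epsilon>" "0 \<le> M * M * N" "0 \<le> (int n + 2) * (2 * B + 1)"
  using num_den_\<epsilon> M_pos N_pos B_nonneg by simp_all

sublocale tv_program n N \<alpha> \<beta> D X L pn pd qn qd
proof
  fix i b
  show "4 \<le> X" "2 * (M * M * N) \<le> X" "(int n + 2) * (2 * B + 1) \<le> X"
    using X_terms_nonneg num_den_\<epsilon> unfolding X_def by linarith+
  have "\<bar>M * M * N\<bar> < 2 ^ L" by (simp add: bits_less_iff L_def)
  then show "M * M * N < 2 ^ L" by linarith
  show "0 \<le> pn (int i)" "pn (int i) \<le> pd (int i)" "0 \<le> qn (int i)" "qn (int i) \<le> qd (int i)"
    using p_bounds[of i] q_bounds[of i] out_of_range[of i] by (cases "i < n"; simp)+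
qed (simp_all add: \<alpha>_def \<beta>_def)

lemma pmf_P: "x \<in> cube n \<Longrightarrow> pmf (bern_prod ps) x = (\<Prod>l<n. of_int (\<alpha> l (x l)) / of_int (D l))"
proof -
  assume "x \<in> cube n"
  then have "pmf (bern_prod ps) x = (\<Prod>i<n. if x i then of_rat (ps ! i) else 1 - of_rat (ps ! i))"
    unfolding n_def using p by (intro pmf_bern_prod_eq) (auto simp: less_imp_le)
  also have "\<dots> = (\<Prod>l<n. of_int (\<alpha> l (x l)) / of_int (D l))"
  proof (rule prod.cong)
    fix l assume "l \<in> {..<n}"
    then have l: "l < n" by simp
    then have "real_of_rat (ps ! l) = of_int (pn (int l)) / of_int (pd (int l))"
      by (simp add: of_rat_num_den pn_def pd_def n_def)
    then show "(if x l then real_of_rat (ps ! l) else 1 - of_rat (ps ! l)) = of_int (\<alpha> l (x l)) / of_int (D l)"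
      using p_bounds[OF l] q_bounds[OF l] by (simp add: \<alpha>_def D_def field_simps)
  qed simp
  finally show ?thesis .
qed

lemma pmf_Q: "x \<in> cube n \<Longrightarrow> pmf (bern_prod qs) x = (\<Prod>l<n. of_int (\<beta> l (x l)) / of_int (D l))"
proof -
  assume "x \<in> cube n"
  then have "pmf (bern_prod qs) x = (\<Prod>i<n. if x i then of_rat (qs ! i) else 1 - of_rat (qs ! i))"
    unfolding n_def len using q len by (intro pmf_bern_prod_eq) (auto simp: less_imp_le)
  also have "\<dots> = (\<Prod>l<n. of_int (\<beta> l (x l)) / of_int (D l))"
  proof (rule prod.cong)
    fix l assume "l \<in> {..<n}"
    then have l: "l < n" by simp
    then have "real_of_rat (qs ! l) = of_int (qn (int l)) / of_int (qd (int l))"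
      using len by (simp add: of_rat_num_den qn_def qd_def n_def)
    then show "(if x l then real_of_rat (qs ! l) else 1 - of_rat (qs ! l)) = of_int (\<beta> l (x l)) / of_int (D l)"
      using p_bounds[OF l] q_bounds[OF l] by (simp add: \<beta>_def D_def field_simps)
  qed simp
  finally show ?thesis .
qed

text \<open>The summand 1 in \<open>N\<close> compensates for the rounding of the quotient. It also
  keeps \<open>N\<close> positive for \<open>n = 0\<close>.\<close>

lemma \<epsilon>_N: "2 * real n \<le> of_rat \<epsilon> * of_int N"
proof -
  have "2 * int n * den \<epsilon> < N * num \<epsilon>"
    using div_mult_mod_eq[of "2 * int n * den \<epsilon>" "num \<epsilon>"] pos_mod_bound[OF num_den_\<epsilon>(1), of "2 * int n * den \<epsilon>"]
    unfolding N_def distrib_right by linarith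
  then have "real_of_int (2 * int n * den \<epsilon>) \<le> of_int (N * num \<epsilon>)" by (simp only: of_int_le_iff)
  then show ?thesis unfolding of_rat_num_den using num_den_\<epsilon> by (simp add: field_simps)
qed

definition steps :: nat where "steps = (n + 4) * (nat width * (40 * L + 400) + 200)"

text \<open>\<open>t\<close> and \<open>v\<close> are fixed before \<open>\<omega>\<close>: all coin
  sequences lead to the same run, so the event of success is the whole space.\<close>

lemma outputs_tv_com:
  obtains t v where "\<And>\<omega>. outputs tv_com (input_state \<epsilon> \<delta> ps qs) \<omega> t v"
    and "t \<le> steps * (bits X)\<^sup>2"
    and "(1 - of_rat \<epsilon>) * dTV (cube (length ps)) (bern_prod ps) (bern_prod qs) \<le> v"
    and "v \<le> dTV (cube (length ps)) (bern_prod ps) (bern_prod qs)"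
proof -
  have "wp X tv_com (\<lambda>a' s'. a' \<le> (n + 4) * (nat width * (40 * L + 400) + 200) \<and>
    ivar s' ''out_num'' = (\<Sum>j\<in>{-B..B}. max 0 (massP n j - massQ n j)) \<and> ivar s' ''out_den'' = M) 0
    (input_state \<epsilon> \<delta> ps qs)"
  proof (rule wp_tv_com[where e = "num \<epsilon>" and d = "den \<epsilon>"])
    show "num \<epsilon> \<le> X" "den \<epsilon> \<le> X" "2 * int n * den \<epsilon> \<le> X"
      using X_terms_nonneg num_den_\<epsilon> unfolding X_def by linarith+
    show "N = 2 * int n * den \<epsilon> div num \<epsilon> + 1" by (rule N_def)
  qed (simp_all add: num_den_\<epsilon> input_state_def n_def pn_def pd_def qn_def qd_def)
  then obtain t a' s' where ex: "\<And>\<omega>. exec tv_com (input_state \<epsilon> \<delta> ps qs) \<omega> t s' \<omega>"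
    and t: "t \<le> a' * (bits X)\<^sup>2" and a': "a' \<le> steps"
    and out: "ivar s' ''out_num'' = (\<Sum>j\<in>{-B..B}. max 0 (massP n j - massQ n j))" "ivar s' ''out_den'' = M"
    unfolding wp_def steps_def mult_0 add_0 by blast
  define v :: real where "v = of_int (\<Sum>j\<in>{-B..B}. max 0 (massP n j - massQ n j)) / of_int M"
  have sub: "set_pmf (bern_prod ps) \<subseteq> cube n" "set_pmf (bern_prod qs) \<subseteq> cube n"
    using set_bern_prod[of ps] set_bern_prod[of qs] len by (simp_all add: n_def)
  note close = output_close[OF pmf_P sub(1) pmf_Q sub(2) \<epsilon>_N v_def]
  show ?thesis
  proof
    show "outputs tv_com (input_state \<epsilon> \<delta> ps qs) \<omega> t v" for \<omega>
      unfolding outputs_def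
      by (intro exI[of _ s'] exI[of _ \<omega>] conjI ex) (simp_all add: v_def out M_pos)
    have "a' * (bits X)\<^sup>2 \<le> steps * (bits X)\<^sup>2" using a' by (rule mult_right_mono) simp
    with t show "t \<le> steps * (bits X)\<^sup>2" by linarith
  qed (use close in \<open>simp_all add: n_def\<close>)
qed

end

section \<open>Running time as a power of one size parameter\<close>

lemma add_le_power:
  fixes s :: nat
  assumes "a \<le> s ^ k" "b \<le> s ^ k" "2 \<le> s"
  shows "a + b \<le> s ^ Suc k"
proof -
  have "a + b \<le> 2 * s ^ k" using assms by linarith
  also have "\<dots> \<le> s * s ^ k" by (rule mult_le_mono1[OF assms(3)])
  finally show ?thesis by simp
qed

lemma mult_le_power: "a \<le> s ^ j \<Longrightarrow> b \<le> s ^ k \<Longrightarrow> a * b \<le> s ^ (j + k)" for s :: nat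
  unfolding power_add by (rule mult_le_mono)

lemma le_power: "a \<le> s ^ j \<Longrightarrow> j \<le> k \<Longrightarrow> 2 \<le> s \<Longrightarrow> a \<le> s ^ k" for s :: nat
  using power_increasing[of j k s] by linarith

lemma sum_list_rat_bits: "sum_list (map rat_bits rs) = (\<Sum>i<length rs. bits (num (rs ! i)) + bits (den (rs ! i)))"
  by (simp add: sum_list_sum_nth lessThan_atLeast0 rat_bits_def)

context tv_input begin

text \<open>Every quantity is bounded by a power of \<open>s\<close>, and the summand 8 makes
  \<open>s\<close> large enough to absorb constants by raising exponents. The exponent is 2 for
  \<open>n + 4\<close>, plus 8 for the width and 6 for the factor linear in \<open>L\<close>, plus 1
  for the added 200, plus 20 for \<open>(bits X)\<^sup>2\<close>.\<close>

lemma steps_le: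
  fixes \<delta> :: rat
  defines "s \<equiv> input_size \<epsilon> \<delta> ps qs + nat \<lceil>1 / real_of_rat \<epsilon>\<rceil> + 8"
  shows "steps * (bits X)\<^sup>2 \<le> s ^ 37"
proof -
  define c where "c = nat \<lceil>1 / real_of_rat \<epsilon>\<rceil>"
  have s8: "8 \<le> s" and s2: "2 \<le> s" and c: "c \<le> s" unfolding s_def c_def by linarith+
  have size_P: "(\<Sum>i<n. bits (num (ps ! i)) + bits (den (ps ! i))) +
      (\<Sum>i<n. bits (num (qs ! i)) + bits (den (qs ! i))) + bits (num \<epsilon>) + bits (den \<epsilon>) + 8 \<le> s"
    using len by (simp add: s_def input_size_def sum_list_rat_bits n_def rat_bits_def)
  have num_s: "bits (num \<epsilon>) \<le> s" "bits (den \<epsilon>) \<le> s" using size_P by linarith+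
  have "n = (\<Sum>i<n. 1)" by simp
  also have "\<dots> \<le> (\<Sum>i<n. bits (num (ps ! i)) + bits (den (ps ! i)))"
    using bits_pos by (intro sum_mono) (simp add: trans_le_add1)
  finally have n: "n + 8 \<le> s" using size_P by linarith
  have "bits M \<le> 2 + (\<Sum>i<n. bits (D i))" unfolding M_def by (intro bits_prod) simp
  also have "(\<Sum>i<n. bits (D i)) \<le> (\<Sum>i<n. bits (den (ps ! i)) + bits (den (qs ! i)))"
    using bits_mult len by (intro sum_mono) (simp add: D_def pd_def qd_def n_def)
  also have "\<dots> \<le> (\<Sum>i<n. bits (num (ps ! i)) + bits (den (ps ! i))) +
      (\<Sum>i<n. bits (num (qs ! i)) + bits (den (qs ! i)))"
    unfolding sum.distrib[symmetric] by (intro sum_mono) simp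
  finally have bM: "bits M \<le> s" using size_P by simp
  \<comment> \<open>Here \<open>1 / \<epsilon>\<close> enters the bound: \<open>N\<close> is
    polynomial in its value \<open>c\<close>, not in the bit length of
    \<open>\<epsilon>\<close>.\<close>
  have N: "nat N \<le> 2 * n * c + 1"
  proof -
    have "1 / real_of_rat \<epsilon> \<le> real c" unfolding c_def by linarith
    then have "real_of_int (den \<epsilon>) \<le> real c * of_int (num \<epsilon>)"
      using num_den_\<epsilon> by (simp add: of_rat_num_den field_simps)
    then have "den \<epsilon> \<le> int c * num \<epsilon>" by (metis of_int_le_iff of_int_mult of_int_of_nat_eq)
    then have "2 * int n * den \<epsilon> \<le> 2 * int n * (int c * num \<epsilon>)" by (intro mult_left_mono) auto
    then have "2 * int n * den \<epsilon> \<le> 2 * int n * int c * num \<epsilon>" by (simp only: mult_ac)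
    then have "2 * int n * den \<epsilon> div num \<epsilon> \<le> 2 * int n * int c * num \<epsilon> div num \<epsilon>"
      using num_den_\<epsilon> by (intro zdiv_mono1)
    then have "N \<le> 2 * int n * int c + 1" using num_den_\<epsilon> by (simp add: N_def)
    then have "N \<le> int (2 * n * c + 1)" by simp
    then show ?thesis by (simp only: nat_le_iff)
  qed
  have nc: "2 * n * c + 2 \<le> 2 * s ^ 2 + 2"
    using mult_le_mono[of n s c s] n c by (simp add: power2_eq_square)
  have s_sq: "64 \<le> s ^ 2" using power_mono[OF s8, of 2] by simp
  have cube: "4 * s ^ 2 \<le> s ^ 3" using mult_right_mono[OF s8, of "s ^ 2"] by (simp add: eval_nat_numeral)
  have N3: "nat N \<le> s ^ 3" using N nc s_sq cube by linarith
  have s_le: "s \<le> s ^ 2" using s8 by (simp add: power2_eq_square)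
  have eight: "8 * s \<le> s ^ 2" using s8 by (simp add: power2_eq_square)
  have bN: "bits N \<le> 2 * n * c + 2" using bits_le_nat[of N] N N_pos by simp
  have L3: "L \<le> s ^ 3"
    using bits_mult[of "M * M" N] bits_mult[of M M] bM bN nc s_sq cube eight unfolding L_def by linarith
  have two: "2 \<le> s ^ k" if "1 \<le> k" for k using le_power[of 2 s 1 k] s2 that by simp
  have one: "1 \<le> s ^ k" for k using s2 by simp
  have M0: "0 \<le> M * M * N" by (rule X_terms_nonneg)
  \<comment> \<open>The logarithmic bound on the index turns the exponentially large argument
    \<open>M * M * N\<close> into the polynomial factor \<open>L + 2\<close>.\<close>
  have "B \<le> N * int (L + 2)"
    unfolding B_def by (rule scale_index_le[OF N_pos L])
  then have "nat B \<le> nat (N * int (L + 2))" by (rule nat_mono)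
  also have "\<dots> = nat N * (L + 2)" using N_pos by (simp only: nat_mult_distrib less_imp_le nat_int)
  also have "\<dots> \<le> s ^ (3 + 4)"
    using add_le_power[OF L3 two[of 3] s2] by (intro mult_le_power N3) simp
  finally have B7: "nat B \<le> s ^ 7" by simp
  have width: "nat width = 2 * nat B + 1" using B_nonneg by simp
  have w8: "nat width + s \<le> s ^ 8"
  proof -
    have "8 * s ^ 7 \<le> s ^ 8" using mult_right_mono[OF s8, of "s ^ 7"] by (simp add: eval_nat_numeral)
    moreover have "s \<le> s ^ 7" using le_power[of s s 1 7] s2 by simp
    ultimately show ?thesis using B7 one[of 7] unfolding width by linarith
  qed
  have bX: "bits X \<le> s ^ 10"
  proof -
    have b2: "bits 2 \<le> 3" using bits_le_nat[of 2] by simp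
    have b4: "bits 4 \<le> 5" using bits_le_nat[of 4] by simp
    have bn: "bits (int n) \<le> s" "bits (int n + 2) \<le> s" using bits_le_nat[of "int n"] bits_le_nat[of "int n + 2"] n by auto
    have "bits (2 * int n * den \<epsilon>) \<le> bits 2 + bits (int n) + bits (den \<epsilon>)"
      using bits_mult[of "2 * int n" "den \<epsilon>"] bits_mult[of 2 "int n"] by linarith
    moreover have "bits (2 * (M * M * N)) \<le> bits 2 + L" using bits_mult[of 2 "M * M * N"] by (simp add: L_def)
    moreover have "bits ((int n + 2) * width) \<le> bits (int n + 2) + bits width" by (rule bits_mult)
    moreover have "bits width \<le> nat width + 1" using bits_le_nat[of width] B_nonneg by simp
    moreover have "bits X \<le> bits 4 + bits (num \<epsilon>) + bits (2 * int n * den \<epsilon>) + bits (den \<epsilon>)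
        + bits (2 * (M * M * N)) + bits ((int n + 2) * width)"
      unfolding X_def by (intro order_trans[OF bits_add] add_mono order_refl)
    ultimately have "bits X \<le> 5 * s + 12 + L + nat width" using num_s b2 b4 bn by linarith
    moreover have "s ^ 3 \<le> s ^ 8" "s ^ 2 \<le> s ^ 8" using s2 by (auto intro: power_increasing)
    moreover have "8 * s ^ 8 \<le> s ^ 9" using mult_right_mono[OF s8, of "s ^ 8"] by (simp add: eval_nat_numeral)
    moreover have "s ^ 9 \<le> s ^ 10" using s2 by (auto intro: power_increasing)
    ultimately show ?thesis using L3 w8 eight s_sq by linarith
  qed
  have l6: "40 * L + 400 \<le> s ^ 6"
  proof -
    have "40 * L \<le> s ^ (2 + 3)" using s_sq by (intro mult_le_power L3) simp
    moreover have "400 \<le> s ^ (2 + 3)" using le_power[of 400 s 3 5] power_mono[OF s8, of 3] s2 by simp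
    ultimately show ?thesis using add_le_power[OF _ _ s2, of "40 * L" 5 400] by simp
  qed
  have "nat width * (40 * L + 400) \<le> s ^ (8 + 6)" using w8 l6 by (intro mult_le_power) auto
  moreover have "200 \<le> s ^ (8 + 6)" using le_power[of 200 s 3 14] power_mono[OF s8, of 3] s2 by simp
  ultimately have "nat width * (40 * L + 400) + 200 \<le> s ^ Suc (8 + 6)" by (rule add_le_power[OF _ _ s2])
  moreover have "n + 4 \<le> s ^ 2" using n s_le by linarith
  ultimately have "steps \<le> s ^ (2 + Suc (8 + 6))" unfolding steps_def by (intro mult_le_power)
  moreover have "(bits X)\<^sup>2 \<le> s ^ (10 + 10)" unfolding power2_eq_square by (intro mult_le_power bX)
  ultimately have "steps * (bits X)\<^sup>2 \<le> s ^ (2 + Suc (8 + 6) + (10 + 10))" by (rule mult_le_power)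
  then show ?thesis by simp
qed

end

theorem theorem2:
  shows "\<exists>(c :: com) (K :: real) (d :: nat).
    \<forall>(\<epsilon> :: rat) (\<delta> :: rat) (ps :: rat list) (qs :: rat list).
      \<epsilon> > 0 \<longrightarrow> \<delta> > 0 \<longrightarrow> length ps = length qs \<longrightarrow>
      (\<forall>i<length ps. 1 / 2 \<le> ps ! i \<and> ps ! i < 1 \<and> 0 < qs ! i \<and> qs ! i \<le> ps ! i) \<longrightarrow>
      (\<forall>\<omega>. \<exists>t v. outputs c (input_state \<epsilon> \<delta> ps qs) \<omega> t v \<and>
        real t \<le> K * (real (input_size \<epsilon> \<delta> ps qs) + 1 / of_rat \<epsilon> + 1 / of_rat \<delta>) ^ d) \<and>
      measure coins {\<omega>. \<exists>t v. outputs c (input_state \<epsilon> \<delta> ps qs) \<omega> t v \<and>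
        (1 - of_rat \<epsilon>) * dTV (cube (length ps)) (bern_prod ps) (bern_prod qs) \<le> v \<and>
        v \<le> (1 + of_rat \<epsilon>) * dTV (cube (length ps)) (bern_prod ps) (bern_prod qs)}
      \<ge> 1 - of_rat \<delta>"
proof (intro exI[of _ tv_com] exI[of _ "10 ^ 37 :: real"] exI[of _ "37 :: nat"] allI impI)
  fix \<epsilon> \<delta> :: rat and ps qs :: "rat list"
  assume \<epsilon>: "\<epsilon> > 0" and \<delta>: "\<delta> > 0" and len: "length ps = length qs"
    and pq: "\<forall>i<length ps. 1 / 2 \<le> ps ! i \<and> ps ! i < 1 \<and> 0 < qs ! i \<and> qs ! i \<le> ps ! i"
  interpret tv_input \<epsilon> ps qs
  proof
    fix i assume "i < length ps"
    with pq have *: "1 / 2 \<le> ps ! i" "ps ! i < 1" "0 < qs ! i" "qs ! i \<le> ps ! i" by auto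
    then show "0 < ps ! i \<and> ps ! i < 1" by (auto intro: less_le_trans[of 0 "1 / 2"])
    show "0 < qs ! i \<and> qs ! i < 1" using * by auto
  qed (fact \<epsilon> len)+
  define size where "size = real (input_size \<epsilon> \<delta> ps qs) + 1 / of_rat \<epsilon> + 1 / of_rat \<delta>"
  define dtv where "dtv = dTV (cube (length ps)) (bern_prod ps) (bern_prod qs)"
  obtain t v where out: "\<And>\<omega>. outputs tv_com (input_state \<epsilon> \<delta> ps qs) \<omega> t v"
    and t: "t \<le> steps * (bits X)\<^sup>2"
    and v: "(1 - of_rat \<epsilon>) * dtv \<le> v" "v \<le> dtv"
    using outputs_tv_com[of \<delta>] unfolding dtv_def by blast
  define s where "s = input_size \<epsilon> \<delta> ps qs + nat \<lceil>1 / real_of_rat \<epsilon>\<rceil> + 8"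
  have pos: "0 < 1 / real_of_rat \<epsilon>" "0 < 1 / real_of_rat \<delta>" using \<epsilon> \<delta> by simp_all
  have "1 \<le> input_size \<epsilon> \<delta> ps qs" using bits_pos[of "num \<epsilon>"] by (simp add: input_size_def rat_bits_def)
  then have "1 \<le> real (input_size \<epsilon> \<delta> ps qs)" by simp
  moreover have "real (nat \<lceil>1 / real_of_rat \<epsilon>\<rceil>) \<le> 1 / of_rat \<epsilon> + 1"
  proof -
    have "0 \<le> \<lceil>1 / real_of_rat \<epsilon>\<rceil>" using pos(1) by linarith
    from of_nat_nat[OF this, where 'a = real] show ?thesis
      using of_int_ceiling_le_add_one[of "1 / real_of_rat \<epsilon>"] by simp
  qed
  \<comment> \<open>Rounding \<open>1 / \<epsilon>\<close> up costs at most 1 and \<open>s\<close>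
    adds 8; since \<open>1 \<le> x\<close>, the sum 9 is absorbed by \<open>9 * x\<close>. This is
    the origin of the constant \<open>10 ^ 37\<close>.\<close>
  moreover have "x + c + 8 \<le> 10 * (x + y + z)" if "1 \<le> x" "c \<le> y + 1" "0 < y" "0 < z" for x c y z :: real
    using that by (simp add: algebra_simps)
  ultimately have "real s \<le> 10 * size" unfolding s_def size_def of_nat_add of_nat_numeral using pos by blast
  then have "real s ^ 37 \<le> (10 * size) ^ 37" by (rule power_mono) simp
  moreover have "real t \<le> real s ^ 37"
    using order_trans[OF t steps_le[of \<delta>]] unfolding s_def by (metis of_nat_le_iff of_nat_power)
  ultimately have time: "real t \<le> 10 ^ 37 * size ^ 37" by (simp only: power_mult_distrib)
  have "0 \<le> real_of_rat \<epsilon> * dtv" using \<epsilon> by (simp add: dtv_def dTV_def sum_nonneg)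
  then have v': "v \<le> (1 + of_rat \<epsilon>) * dtv" using v(2) by (simp add: distrib_right)
  \<comment> \<open>The successful coin sequences form the whole space, which is measurable and has
    probability 1.\<close>
  have all: "{\<omega>. \<exists>t v. outputs tv_com (input_state \<epsilon> \<delta> ps qs) \<omega> t v \<and>
      (1 - of_rat \<epsilon>) * dtv \<le> v \<and> v \<le> (1 + of_rat \<epsilon>) * dtv} = space coins"
    unfolding space_coins using out v(1) v' by blast
  show "(\<forall>\<omega>. \<exists>t v. outputs tv_com (input_state \<epsilon> \<delta> ps qs) \<omega> t v \<and>
        real t \<le> 10 ^ 37 * (real (input_size \<epsilon> \<delta> ps qs) + 1 / of_rat \<epsilon> + 1 / of_rat \<delta>) ^ 37) \<and>
      measure coins {\<omega>. \<exists>t v. outputs tv_com (input_state \<epsilon> \<delta> ps qs) \<omega> t v \<and>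
        (1 - of_rat \<epsilon>) * dTV (cube (length ps)) (bern_prod ps) (bern_prod qs) \<le> v \<and>
        v \<le> (1 + of_rat \<epsilon>) * dTV (cube (length ps)) (bern_prod ps) (bern_prod qs)}
      \<ge> 1 - of_rat \<delta>"
    unfolding dtv_def[symmetric] size_def[symmetric] all
      prob_space.prob_space[OF prob_space_coins]
    using out time \<delta> by auto
qed

end
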